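(* Let $G$ be an Abelian group (written multiplicatively), $R$ a commutative ring with unity, $\varphi:\mathbb{Z}^d\to G$ a homomorphism, $w\in R[x_1,\dots,x_d]$ a polynomial, and $P\subset\mathbb{R}^d$ a rational polytope. Then, as rational functions in $z_1,\dots,z_d$ with coefficients in $R[G]$, $$\sigma(P,\varphi,w;\mathbf z)=\sum_{v\text{ vertex of }P}\sigma(K_{v,P},\varphi,w;\mathbf z).$$
   Context: $R[G]$ is the group ring. For a rational polyhedron $Q\subset\mathbb{R}^d$, the $w$-weighted $\varphi$-integer point transform is $\sigma(Q,\varphi,w;\mathbf z)=\sum_{\alpha\in Q\cap\mathbb{Z}^d}w(\alpha)\varphi(\alpha)\mathbf z^{\alpha}$, where $\mathbf z^\alpha=z_1^{\alpha_1}\cdots z_d^{\alpha_d}$; for pointed rational cones this formal series is identified with a multivariate rational function in $z_1,\dots,z_d$ with coefficients in $R[G]$. For a vertex $v$ of $P$, the vertex cone is $K_{v,P}=\{v+\lambda(u-v):u\in P,\ \lambda\ge0\}$. *)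

theory Defs
  imports "HOL-Analysis.Analysis" "HOL-Library.Poly_Mapping"
begin

section \<open>The total ring of fractions of a commutative ring\<close>

text \<open>A Laurent polynomial ring over a group ring usually has zero divisors, so the fraction
  field of the library is not applicable. We invert exactly the elements that are not zero
  divisors.\<close>

definition non_zero_divisor :: "'a::comm_ring_1 \<Rightarrow> bool" where
  "non_zero_divisor a \<longleftrightarrow> (\<forall>x. a * x = 0 \<longrightarrow> x = 0)"

lemma non_zero_divisor_1 [simp]: "non_zero_divisor 1"
  by (simp add: non_zero_divisor_def)

lemma non_zero_divisor_mult [simp]:
  "non_zero_divisor a \<Longrightarrow> non_zero_divisor b \<Longrightarrow> non_zero_divisor (a * b)"
  unfolding non_zero_divisor_def mult.assoc by blast

lemma non_zero_divisor_cancel: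
  assumes "non_zero_divisor a"
  shows "a * x = a * y \<longleftrightarrow> x = y"
proof
  assume "a * x = a * y"
  then have "a * (x - y) = 0" by (simp only: right_diff_distrib diff_self)
  then have "x - y = 0" using assms unfolding non_zero_divisor_def by blast
  then show "x = y" by (simp only: right_minus_eq)
qed simp

definition tfracrel :: "'a::comm_ring_1 \<times> 'a \<Rightarrow> 'a \<times> 'a \<Rightarrow> bool" where
  "tfracrel x y \<longleftrightarrow> non_zero_divisor (snd x) \<and> non_zero_divisor (snd y)
     \<and> fst x * snd y = fst y * snd x"

lemma part_equivp_tfracrel: "part_equivp (tfracrel :: 'a::comm_ring_1 \<times> 'a \<Rightarrow> _)"
proof (rule part_equivpI)
  show "\<exists>x :: 'a \<times> 'a. tfracrel x x"
    by (rule exI[where x = "(0, 1)"]) (simp add: tfracrel_def)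
  show "symp (tfracrel :: 'a \<times> 'a \<Rightarrow> _)"
    by (auto simp: symp_def tfracrel_def)
  show "transp (tfracrel :: 'a \<times> 'a \<Rightarrow> _)"
  proof (rule transpI, unfold split_paired_all)
    fix a b a' b' a'' b'' :: 'a
    assume A: "tfracrel (a, b) (a', b')" and B: "tfracrel (a', b') (a'', b'')"
    have "b' * (a * b'') = b'' * (a * b')" by (simp add: ac_simps)
    also have "a * b' = a' * b" using A by (simp add: tfracrel_def)
    also have "b'' * (a' * b) = b * (a' * b'')" by (simp add: ac_simps)
    also have "a' * b'' = a'' * b'" using B by (simp add: tfracrel_def)
    also have "b * (a'' * b') = b' * (a'' * b)" by (simp add: ac_simps)
    finally have "a * b'' = a'' * b"
      using A by (simp add: tfracrel_def non_zero_divisor_cancel)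
    then show "tfracrel (a, b) (a'', b'')"
      using A B by (simp add: tfracrel_def)
  qed
qed

quotient_type (overloaded) 'a tfrac = "'a::comm_ring_1 \<times> 'a" / partial: "tfracrel"
  by (rule part_equivp_tfracrel)

text \<open>If \<open>b\<close> is a zero divisor, \<open>TFract a b\<close> is the dummy value \<open>0\<close>.\<close>

lift_definition TFract :: "'a::comm_ring_1 \<Rightarrow> 'a \<Rightarrow> 'a tfrac"
  is "\<lambda>a b. if non_zero_divisor b then (a, b) else (0, 1)"
  by (simp add: tfracrel_def)

lemma TFract_cases [cases type: tfrac]:
  obtains (TFract) a b where "q = TFract a b" "non_zero_divisor b"
  by transfer (auto simp: tfracrel_def)

lemma TFract_eq_iff:
  "non_zero_divisor b \<Longrightarrow> non_zero_divisor d \<Longrightarrow> TFract a b = TFract c d \<longleftrightarrow> a * d = c * b"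
  by transfer (simp add: tfracrel_def)

instantiation tfrac :: (comm_ring_1) comm_ring_1
begin

lift_definition zero_tfrac :: "'a tfrac" is "(0, 1)"
  by (simp add: tfracrel_def)

lift_definition one_tfrac :: "'a tfrac" is "(1, 1)"
  by (simp add: tfracrel_def)

lift_definition plus_tfrac :: "'a tfrac \<Rightarrow> 'a tfrac \<Rightarrow> 'a tfrac"
  is "\<lambda>q r. (fst q * snd r + fst r * snd q, snd q * snd r)"
proof -
  fix p p' q q' :: "'a \<times> 'a"
  assume "tfracrel p p'" "tfracrel q q'"
  then have A: "fst p * snd p' = fst p' * snd p" "fst q * snd q' = fst q' * snd q"
    and nzd: "non_zero_divisor (snd p)" "non_zero_divisor (snd p')"
      "non_zero_divisor (snd q)" "non_zero_divisor (snd q')"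
    unfolding tfracrel_def by blast+
  have "(fst p * snd q + fst q * snd p) * (snd p' * snd q')
      = (fst p * snd p') * (snd q * snd q') + (fst q * snd q') * (snd p * snd p')"
    by (simp add: algebra_simps)
  also have "\<dots> = (fst p' * snd q' + fst q' * snd p') * (snd p * snd q)"
    unfolding A by (simp add: algebra_simps)
  finally show "tfracrel (fst p * snd q + fst q * snd p, snd p * snd q)
      (fst p' * snd q' + fst q' * snd p', snd p' * snd q')"
    unfolding tfracrel_def fst_conv snd_conv by (intro conjI non_zero_divisor_mult nzd)
qed

lift_definition uminus_tfrac :: "'a tfrac \<Rightarrow> 'a tfrac" is "\<lambda>q. (- fst q, snd q)"
  by (simp add: tfracrel_def)

definition minus_tfrac :: "'a tfrac \<Rightarrow> 'a tfrac \<Rightarrow> 'a tfrac" where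
  "minus_tfrac q r = q + - r"

lift_definition times_tfrac :: "'a tfrac \<Rightarrow> 'a tfrac \<Rightarrow> 'a tfrac"
  is "\<lambda>q r. (fst q * fst r, snd q * snd r)"
proof -
  fix p p' q q' :: "'a \<times> 'a"
  assume "tfracrel p p'" "tfracrel q q'"
  then have A: "fst p * snd p' = fst p' * snd p" "fst q * snd q' = fst q' * snd q"
    and nzd: "non_zero_divisor (snd p)" "non_zero_divisor (snd p')"
      "non_zero_divisor (snd q)" "non_zero_divisor (snd q')"
    unfolding tfracrel_def by blast+
  have "(fst p * fst q) * (snd p' * snd q') = (fst p * snd p') * (fst q * snd q')"
    by (simp add: algebra_simps)
  also have "\<dots> = (fst p' * fst q') * (snd p * snd q)"
    unfolding A by (simp add: algebra_simps)
  finally show "tfracrel (fst p * fst q, snd p * snd q) (fst p' * fst q', snd p' * snd q')"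
    unfolding tfracrel_def fst_conv snd_conv by (intro conjI non_zero_divisor_mult nzd)
qed

lemma zero_tfrac_TFract: "0 = TFract 0 (1::'a)"
  by transfer (simp add: tfracrel_def)

lemma one_tfrac_TFract: "1 = TFract 1 (1::'a)"
  by transfer (simp add: tfracrel_def)

lemma add_TFract: "non_zero_divisor b \<Longrightarrow> non_zero_divisor d \<Longrightarrow>
    TFract a b + TFract c d = TFract (a * d + c * b) (b * (d::'a))"
  by transfer (simp add: tfracrel_def)

lemma uminus_TFract: "non_zero_divisor b \<Longrightarrow> - TFract a b = TFract (- a) (b::'a)"
  by transfer (simp add: tfracrel_def)

lemma mult_TFract: "non_zero_divisor b \<Longrightarrow> non_zero_divisor d \<Longrightarrow>
    TFract a b * TFract c d = TFract (a * c) (b * (d::'a))"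
  by transfer (simp add: tfracrel_def)

instance
proof
  fix q r s :: "'a tfrac"
  note [simp] = TFract_eq_iff add_TFract uminus_TFract mult_TFract
    zero_tfrac_TFract one_tfrac_TFract minus_tfrac_def algebra_simps
  show "(q * r) * s = q * (r * s)" by (cases q, cases r, cases s) simp
  show "q * r = r * q" by (cases q, cases r) simp
  show "1 * q = q" by (cases q) simp
  show "(q + r) + s = q + (r + s)" by (cases q, cases r, cases s) simp
  show "q + r = r + q" by (cases q, cases r) simp
  show "0 + q = q" by (cases q) simp
  show "- q + q = 0" by (cases q) simp
  show "q - r = q + - r" by simp
  show "(q + r) * s = q * s + r * s" by (cases q, cases r, cases s) simp
  show "(0 :: 'a tfrac) \<noteq> 1" by simp
qed

end


section \<open>Group rings, Laurent polynomials, formal series and rational functions\<close>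

text \<open>Poly_Mapping multiplies by convolution over the additively written index monoid. Hence, for
  \<open>'g :: ab_group_add\<close>, the type below is the group ring \<open>R[G]\<close>; the group element \<open>g\<close>
  is \<open>Poly_Mapping.single g 1\<close>, and the sum in \<open>'g\<close> is the product in \<open>G\<close>.\<close>

type_synonym ('g, 'r) group_ring = "'g \<Rightarrow>\<^sub>0 'r"

text \<open>With exponents in \<open>int ^ 'd\<close> one obtains the ring of Laurent polynomials in the variables
  \<open>z\<^sub>i\<close>, \<open>i :: 'd\<close>; the monomial \<open>z\<^sup>\<alpha>\<close> is \<open>Poly_Mapping.single \<alpha> 1\<close>. Since monomials are not
  zero divisors, its total ring of fractions is that of the polynomial ring.\<close>

type_synonym ('d, 'a) laurent_poly = "(int ^ 'd) \<Rightarrow>\<^sub>0 'a"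

type_synonym ('d, 'a) rational_function = "('d, 'a) laurent_poly tfrac"

text \<open>A formal series \<open>\<Sum>\<^sub>\<alpha> f(\<alpha>) z\<^sup>\<alpha>\<close> is its coefficient function. Such series cannot be multiplied
  with each other in general, but they form a module over the Laurent polynomials.\<close>

type_synonym ('d, 'a) formal_series = "int ^ 'd \<Rightarrow> 'a"

definition laurent_act ::
    "('d::finite, 'a::comm_ring_1) laurent_poly \<Rightarrow> ('d, 'a) formal_series \<Rightarrow> ('d, 'a) formal_series"
  where "laurent_act q f = (\<lambda>\<alpha>. \<Sum>\<beta>\<in>Poly_Mapping.keys q. Poly_Mapping.lookup q \<beta> * f (\<alpha> - \<beta>))"

text \<open>The series \<open>f\<close> is identified with the fraction \<open>p / q\<close> if \<open>q f = p\<close>.\<close>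

definition series_represents ::
    "('d::finite, 'a::comm_ring_1) formal_series \<Rightarrow> ('d, 'a) rational_function \<Rightarrow> bool" where
  "series_represents f F \<longleftrightarrow>
     (\<exists>p q. non_zero_divisor q \<and> laurent_act q f = Poly_Mapping.lookup p \<and> F = TFract p q)"

definition series_to_rational ::
    "('d::finite, 'a::comm_ring_1) formal_series \<Rightarrow> ('d, 'a) rational_function" where
  "series_to_rational f = (THE F. series_represents f F)"

lemma laurent_act_superset:
  assumes "finite S" "Poly_Mapping.keys q \<subseteq> S"
  shows "laurent_act q f \<alpha> = (\<Sum>\<beta>\<in>S. Poly_Mapping.lookup q \<beta> * f (\<alpha> - \<beta>))"
  unfolding laurent_act_def using assms
  by (intro sum.mono_neutral_left) (auto simp: Poly_Mapping.in_keys_iff)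

lemma laurent_act_zero [simp]: "laurent_act 0 f = (\<lambda>_. 0)"
  by (simp add: laurent_act_def)

lemma laurent_act_single:
  "laurent_act (Poly_Mapping.single \<beta> c) f = (\<lambda>\<alpha>. c * f (\<alpha> - \<beta>))"
  by (rule ext, subst laurent_act_superset[where S = "{\<beta>}"]) auto

lemma laurent_act_add:
  "laurent_act (p + q) f = (\<lambda>\<alpha>. laurent_act p f \<alpha> + laurent_act q f \<alpha>)"
proof (rule ext)
  fix \<alpha>
  let ?S = "Poly_Mapping.keys p \<union> Poly_Mapping.keys q"
  have "Poly_Mapping.keys (p + q) \<subseteq> ?S" by (rule Poly_Mapping.keys_add)
  then show "laurent_act (p + q) f \<alpha> = laurent_act p f \<alpha> + laurent_act q f \<alpha>"
    by (simp add: laurent_act_superset[of ?S] Poly_Mapping.lookup_add distrib_right sum.distrib)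
qed

lemma laurent_act_distrib_right:
  "laurent_act p (\<lambda>\<alpha>. f \<alpha> + g \<alpha>) = (\<lambda>\<alpha>. laurent_act p f \<alpha> + laurent_act p g \<alpha>)"
  by (simp add: laurent_act_def distrib_left sum.distrib)

lemma poly_mapping_add_induct [case_names zero single_add]:
  fixes p :: "'b \<Rightarrow>\<^sub>0 'a::comm_monoid_add"
  assumes "P 0" "\<And>k c p. P p \<Longrightarrow> P (Poly_Mapping.single k c + p)"
  shows "P p"
proof (induction p rule: Poly_Mapping.update_induct)
  case const
  then show ?case using assms(1) by simp
next
  case (update p k c)
  have "Poly_Mapping.update k c p = Poly_Mapping.single k c + p"
    using update by (intro poly_mapping_eqI)
      (auto simp: Poly_Mapping.lookup_update Poly_Mapping.lookup_add
          Poly_Mapping.lookup_single when_def Poly_Mapping.in_keys_iff)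
  then show ?case using assms(2) update by simp
qed

lemma laurent_act_mult:
  "laurent_act (p * q) f = laurent_act p (laurent_act q f)"
proof (induction p rule: poly_mapping_add_induct)
  case zero
  then show ?case by simp
next
  case (single_add k c p)
  have "laurent_act (Poly_Mapping.single k c * q) f
      = laurent_act (Poly_Mapping.single k c) (laurent_act q f)"
  proof (induction q rule: poly_mapping_add_induct)
    case zero
    then show ?case by (simp add: laurent_act_single)
  next
    case (single_add j b q)
    then show ?case
      by (simp add: distrib_left laurent_act_add laurent_act_single mult_single
          diff_diff_add add.commute mult.assoc)
  qed
  with single_add show ?case by (simp add: distrib_right laurent_act_add)
qed

lemma laurent_act_lookup: "laurent_act q (Poly_Mapping.lookup p) = Poly_Mapping.lookup (q * p)"
proof (induction q rule: poly_mapping_add_induct)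
  case zero
  then show ?case by (simp add: fun_eq_iff)
next
  case (single_add k c q)
  have "laurent_act (Poly_Mapping.single k c) (Poly_Mapping.lookup p)
      = Poly_Mapping.lookup (Poly_Mapping.single k c * p)"
  proof (induction p rule: poly_mapping_add_induct)
    case zero
    then show ?case by (simp add: laurent_act_single fun_eq_iff)
  next
    case (single_add j b p)
    then show ?case
      by (auto simp: fun_eq_iff laurent_act_single Poly_Mapping.lookup_add mult_single distrib_left
          Poly_Mapping.lookup_single when_def algebra_simps)
  qed
  with single_add show ?case
    by (simp add: laurent_act_add distrib_right Poly_Mapping.lookup_add fun_eq_iff)
qed

lemma series_represents_unique:
  assumes "series_represents f F" "series_represents f F'"
  shows "F = F'"
proof -
  obtain p q where p: "non_zero_divisor q" "laurent_act q f = Poly_Mapping.lookup p"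
      "F = TFract p q"
    using assms(1) by (auto simp: series_represents_def)
  obtain p' q' where p': "non_zero_divisor q'" "laurent_act q' f = Poly_Mapping.lookup p'"
      "F' = TFract p' q'"
    using assms(2) by (auto simp: series_represents_def)
  have "Poly_Mapping.lookup (q' * p) = laurent_act (q' * q) f"
    by (simp add: laurent_act_mult laurent_act_lookup p)
  also have "\<dots> = Poly_Mapping.lookup (q * p')"
    by (subst mult.commute) (simp add: laurent_act_mult laurent_act_lookup p')
  finally have "q' * p = q * p'" by (intro poly_mapping_eqI) (simp add: fun_eq_iff)
  then show ?thesis using p p' by (simp add: TFract_eq_iff mult.commute)
qed

lemma series_to_rational_eqI: "series_represents f F \<Longrightarrow> series_to_rational f = F"
  unfolding series_to_rational_def by (blast intro: series_represents_unique)

lemma series_to_rational_lookup: "series_to_rational (Poly_Mapping.lookup p) = TFract p 1"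
  by (rule series_to_rational_eqI)
     (auto simp: series_represents_def laurent_act_lookup intro!: exI[of _ p] exI[of _ 1])


section \<open>Weighted integer point transforms and vertex cones\<close>

text \<open>The value at an integer point of a polynomial, given by its coefficients indexed by exponent
  vectors.\<close>

definition poly_eval :: "(('d::finite \<Rightarrow>\<^sub>0 nat) \<Rightarrow>\<^sub>0 'r::comm_ring_1) \<Rightarrow> int ^ 'd \<Rightarrow> 'r" where
  "poly_eval w \<alpha> =
     (\<Sum>m\<in>Poly_Mapping.keys w. Poly_Mapping.lookup w m *
       (\<Prod>i\<in>UNIV. of_int (\<alpha> $ i) ^ Poly_Mapping.lookup m i))"

definition real_vec :: "int ^ 'd \<Rightarrow> real ^ 'd" where
  "real_vec \<alpha> = (\<chi> i. of_int (\<alpha> $ i))"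

definition point_series ::
    "(real ^ 'd::finite) set \<Rightarrow> (int ^ 'd \<Rightarrow> 'g::ab_group_add) \<Rightarrow> (('d \<Rightarrow>\<^sub>0 nat) \<Rightarrow>\<^sub>0 'r::comm_ring_1)
     \<Rightarrow> ('d, ('g, 'r) group_ring) formal_series" where
  "point_series Q \<phi> w =
     (\<lambda>\<alpha>. if real_vec \<alpha> \<in> Q then Poly_Mapping.single (\<phi> \<alpha>) (poly_eval w \<alpha>) else 0)"

definition point_transform ::
    "(real ^ 'd::finite) set \<Rightarrow> (int ^ 'd \<Rightarrow> 'g::ab_group_add) \<Rightarrow> (('d \<Rightarrow>\<^sub>0 nat) \<Rightarrow>\<^sub>0 'r::comm_ring_1)
     \<Rightarrow> ('d, ('g, 'r) group_ring) rational_function" where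
  "point_transform Q \<phi> w = series_to_rational (point_series Q \<phi> w)"

definition rational_polytope :: "(real ^ 'd::finite) set \<Rightarrow> bool" where
  "rational_polytope P \<longleftrightarrow> polytope P \<and> (\<forall>v. v extreme_point_of P \<longrightarrow> (\<forall>i. v $ i \<in> \<rat>))"

definition vertex_cone :: "real ^ 'd::finite \<Rightarrow> (real ^ 'd) set \<Rightarrow> (real ^ 'd) set" where
  "vertex_cone v P = {v + c *\<^sub>R (u - v) | u c. u \<in> P \<and> c \<ge> 0}"

end

theory Submission
  imports Defs
begin

text \<open>Write \<open>P\<close> as an intersection of halfspaces with rational normals. For a product of halfspace
  indicators let its germ at \<open>v\<close> be its homogenization at \<open>v\<close>: the limit of its value at
  \<open>v + \<epsilon> (x - v)\<close> as \<open>\<epsilon>\<close> decreases to \<open>0\<close>. The germ of \<open>P\<close> is the indicator of \<open>K\<^sub>v\<close> if \<open>v \<in> P\<close> and \<open>0\<close>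
  otherwise. Every product of halfspace indicators equals the sum of its germs at finitely
  many points, up to a function whose weighted series is annihilated by a non zero
  divisor.

  A linear dependence among the normals makes some sign pattern of the halfspaces infeasible;
  expanding the corresponding vanishing product expresses the indicator, and by passage to the
  limit also each germ, through products of fewer halfspaces. This reduces the claim to linearly
  independent normals. There the product is a simplicial cone equal to its own germ at the apex,
  or it is periodic along an integer direction; all its other germs are periodic along such
  directions. For an integer vector \<open>u\<close>, multiplication by \<open>1 - \<phi>(u) z\<^sup>u\<close> acts on the weights as a
  difference operator, so a power of it annihilates \<open>u\<close>-periodic series with polynomial weights, and a product of such powers over the
  rays of a simplicial cone leaves a finitely supported series.\<close>

section \<open>Rational vectors and dual bases\<close>

definition rat_vec :: "rat ^ 'd \<Rightarrow> real ^ 'd" where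
  "rat_vec a = (\<chi> i. of_rat (a $ i))"

lemma rat_vec_add: "rat_vec (a + b) = rat_vec a + rat_vec b"
  by (simp add: rat_vec_def vec_eq_iff of_rat_add)

lemma rat_vec_diff: "rat_vec (a - b) = rat_vec a - rat_vec b"
  by (simp add: rat_vec_def vec_eq_iff of_rat_diff)

lemma rat_vec_minus: "rat_vec (- a) = - rat_vec a"
  by (simp add: rat_vec_def vec_eq_iff of_rat_minus)

lemma rat_vec_scale: "rat_vec (c *s a) = of_rat c *\<^sub>R rat_vec a"
  by (simp add: rat_vec_def vec_eq_iff of_rat_mult)

lemma rat_vec_zero [simp]: "rat_vec 0 = 0"
  by (simp add: rat_vec_def vec_eq_iff)

lemma rat_vec_sum: "rat_vec (sum f A) = (\<Sum>x\<in>A. rat_vec (f x))"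
  by (induction A rule: infinite_finite_induct) (auto simp: rat_vec_add)

lemma rat_vec_axis: "rat_vec (axis i 1) = axis i 1"
  by (simp add: rat_vec_def vec_eq_iff axis_def)

lemma rat_vec_inner_rat_vec: "rat_vec a \<bullet> rat_vec b = of_rat (\<Sum>i\<in>UNIV. a $ i * b $ i)"
  by (simp add: rat_vec_def inner_vec_def of_rat_sum of_rat_mult)

lemma real_vec_diff: "real_vec (\<alpha> - \<beta>) = real_vec \<alpha> - real_vec \<beta>"
  by (simp add: real_vec_def vec_eq_iff)

lemma real_vec_zero [simp]: "real_vec 0 = 0"
  by (simp add: real_vec_def vec_eq_iff)

lemma rational_common_denominator:
  fixes y :: "rat ^ 'd::finite"
  obtains k :: int and u :: "int ^ 'd" where "k > 0" "real_vec u = of_int k *\<^sub>R rat_vec y"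
proof -
  define k where "k = (\<Prod>i\<in>UNIV. snd (quotient_of (y $ i)))"
  have pos: "snd (quotient_of q) > 0" for q
    by (metis prod.collapse quotient_of_denom_pos)
  have k: "k > 0" unfolding k_def using pos by (intro prod_pos) auto
  have "\<exists>m::int. of_int m = of_int k * y $ i" for i
  proof -
    have dvd: "snd (quotient_of (y $ i)) dvd k"
      unfolding k_def by (rule dvd_prodI) auto
    then obtain l where l: "k = snd (quotient_of (y $ i)) * l" by (auto simp: dvd_def)
    have "y $ i = of_int (fst (quotient_of (y $ i))) / of_int (snd (quotient_of (y $ i)))"
      by (metis prod.collapse quotient_of_div)
    then have "of_int k * y $ i = of_int (fst (quotient_of (y $ i)) * l)"
      using pos[of "y $ i"] by (simp add: l field_simps)
    then show ?thesis by metis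
  qed
  then obtain m where m: "\<And>i. of_int (m i) = of_int k * y $ i" by metis
  have "real_vec (\<chi> i. m i) = of_int k *\<^sub>R rat_vec y"
  proof (simp add: vec_eq_iff real_vec_def rat_vec_def, intro allI)
    fix i
    have "real_of_rat (of_int (m i)) = real_of_rat (of_int k * y $ i)" using m by simp
    then show "real_of_int (m i) = of_int k * of_rat (y $ i)" by (simp only: of_rat_mult of_rat_of_int_eq)
  qed
  with k that show ?thesis by blast
qed

text \<open>For each \<open>b\<close>, extend to a linear map the assignment that is nonzero at
  \<open>b\<close> and zero on the rest of \<open>B\<close>. A coordinate of this map is the pairing
  with a rational vector; clearing denominators makes that vector integral.\<close>

lemma rational_dual_vectors:
  fixes B :: "(rat ^ 'd::finite) set"
  assumes "vec.independent B"
  obtains u :: "rat ^ 'd \<Rightarrow> int ^ 'd" where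
    "\<And>a. a \<in> B \<Longrightarrow> rat_vec a \<bullet> real_vec (u a) > 0"
    "\<And>a b. a \<in> B \<Longrightarrow> b \<in> B \<Longrightarrow> a \<noteq> b \<Longrightarrow> rat_vec a \<bullet> real_vec (u b) = 0"
proof -
  have "\<exists>u::int^'d. rat_vec b \<bullet> real_vec u > 0 \<and> (\<forall>a\<in>B. a \<noteq> b \<longrightarrow> rat_vec a \<bullet> real_vec u = 0)"
    if b: "b \<in> B" for b
  proof -
    define f :: "rat ^ 'd \<Rightarrow> rat ^ 'd" where "f = (\<lambda>a. if a = b then 1 else 0)"
    obtain g :: "rat ^ 'd \<Rightarrow> rat ^ 'd" where lin: "Vector_Spaces.linear (*s) (*s) g"
        and g: "\<And>a. a \<in> B \<Longrightarrow> g a = f a"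
      using vec.linear_independent_extend[OF assms, of f] by blast
    \<comment> \<open>Any coordinate will do, since \<open>f b\<close> is the all-ones
      vector.\<close>
    fix i0 :: 'd
    define y :: "rat ^ 'd" where "y = (\<chi> i. g (axis i 1) $ i0)"
    have ay: "rat_vec a \<bullet> rat_vec y = of_rat (g a $ i0)" for a
      unfolding rat_vec_inner_rat_vec y_def linear_componentwise[OF lin, of a i0] by simp
    obtain k :: int and u :: "int ^ 'd" where ku: "k > 0" "real_vec u = of_int k *\<^sub>R rat_vec y"
      using rational_common_denominator by blast
    show ?thesis
      using ku b by (intro exI[of _ u]) (auto simp: ay g f_def)
  qed
  then show ?thesis using that by metis
qed

lemma orthogonal_to_span:
  assumes "x \<in> vec.span A" "\<And>a. a \<in> A \<Longrightarrow> rat_vec a \<bullet> y = 0"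
  shows "rat_vec x \<bullet> y = 0"
  using assms(1)
  by (induction rule: vec.span_induct_alt)
     (auto simp: rat_vec_add rat_vec_scale inner_add_left assms(2))

text \<open>Adjoin a vector \<open>b\<close> outside the span to a basis of the span. The dual
  vector of \<open>b\<close> is orthogonal to the basis, hence to \<open>A\<close>, and is nonzero
  because it pairs positively with \<open>b\<close>.\<close>

lemma integer_orthogonal_vector:
  fixes A :: "(rat ^ 'd::finite) set"
  assumes "vec.span A \<noteq> UNIV"
  obtains u :: "int ^ 'd" where "u \<noteq> 0" "\<And>a. a \<in> A \<Longrightarrow> rat_vec a \<bullet> real_vec u = 0"
proof -
  obtain B where B: "B \<subseteq> A" "vec.independent B" "A \<subseteq> vec.span B"
    using vec.maximal_independent_subset by blast
  obtain b where b: "b \<notin> vec.span B"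
    using assms vec.span_mono[OF B(1)] by blast
  then have "b \<notin> B" and ind: "vec.independent (insert b B)"
    using B(2) by (auto intro: vec.span_base simp: vec.independent_insert)
  obtain u where dual: "\<And>a. a \<in> insert b B \<Longrightarrow> rat_vec a \<bullet> real_vec (u a) > 0"
    "\<And>a c. a \<in> insert b B \<Longrightarrow> c \<in> insert b B \<Longrightarrow> a \<noteq> c \<Longrightarrow> rat_vec a \<bullet> real_vec (u c) = 0"
    using rational_dual_vectors[OF ind] by blast
  have u: "rat_vec b \<bullet> real_vec (u b) > 0" "\<And>a. a \<in> B \<Longrightarrow> rat_vec a \<bullet> real_vec (u b) = 0"
    using dual \<open>b \<notin> B\<close> by auto
  show ?thesis
  proof
    show "u b \<noteq> 0" using u(1) by auto
    show "rat_vec a \<bullet> real_vec (u b) = 0" if "a \<in> A" for a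
      using that B(3) u(2) by (intro orthogonal_to_span[of a B]) auto
  qed
qed

lemma spanning_orthogonal_zero:
  fixes y :: "real ^ 'd::finite"
  assumes "vec.span A = UNIV" "\<And>a. a \<in> A \<Longrightarrow> rat_vec a \<bullet> y = 0"
  shows "y = 0"
proof -
  have "rat_vec (axis i 1) \<bullet> y = 0" for i
    by (rule orthogonal_to_span[of _ A]) (use assms in auto)
  then show ?thesis by (simp add: rat_vec_axis vec_eq_iff inner_axis')
qed

lemma finite_integer_vectors_bounded:
  "finite {\<alpha> :: int ^ 'd::finite. \<forall>i. \<bar>\<alpha> $ i\<bar> \<le> k}"
proof -
  have "{\<alpha> :: int ^ 'd. \<forall>i. \<bar>\<alpha> $ i\<bar> \<le> k} \<subseteq> vec_lambda ` (PiE UNIV (\<lambda>_. {-k..k}))"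
  proof
    fix \<alpha> :: "int ^ 'd" assume "\<alpha> \<in> {\<alpha>. \<forall>i. \<bar>\<alpha> $ i\<bar> \<le> k}"
    then show "\<alpha> \<in> vec_lambda ` (PiE UNIV (\<lambda>_. {-k..k}))"
      by (intro image_eqI[of _ _ "vec_nth \<alpha>"]) (auto simp: abs_le_iff minus_le_iff)
  qed
  then show ?thesis by (rule finite_subset) (intro finite_imageI finite_PiE, auto)
qed

text \<open>Bounds on the pairings with \<open>A\<close> pass to linear combinations. As
  \<open>A\<close> spans, they reach the unit vectors and so bound every coordinate.\<close>

lemma finite_integer_parallelepiped:
  fixes A :: "(rat ^ 'd::finite) set"
  assumes "vec.span A = UNIV"
    and Z: "\<And>\<alpha> a. \<alpha> \<in> Z \<Longrightarrow> a \<in> A \<Longrightarrow> \<bar>rat_vec a \<bullet> real_vec \<alpha>\<bar> \<le> K a"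
  shows "finite (Z :: (int ^ 'd) set)"
proof -
  have "\<exists>C. \<forall>\<alpha>\<in>Z. \<bar>rat_vec x \<bullet> real_vec \<alpha>\<bar> \<le> C" if "x \<in> vec.span A" for x
    using that
  proof (induction rule: vec.span_induct_alt)
    case base
    then show ?case by (auto intro: exI[of _ 0])
  next
    case (step c a y)
    then obtain C where C: "\<forall>\<alpha>\<in>Z. \<bar>rat_vec y \<bullet> real_vec \<alpha>\<bar> \<le> C" by blast
    have "\<bar>rat_vec (c *s a + y) \<bullet> real_vec \<alpha>\<bar> \<le> \<bar>of_rat c\<bar> * K a + C" if "\<alpha> \<in> Z" for \<alpha>
    proof -
      have "\<bar>rat_vec (c *s a + y) \<bullet> real_vec \<alpha>\<bar>
          \<le> \<bar>of_rat c\<bar> * \<bar>rat_vec a \<bullet> real_vec \<alpha>\<bar> + \<bar>rat_vec y \<bullet> real_vec \<alpha>\<bar>"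
        unfolding rat_vec_add rat_vec_scale inner_add_left inner_scaleR_left abs_mult[symmetric]
        by (rule abs_triangle_ineq)
      also have "\<dots> \<le> \<bar>of_rat c\<bar> * K a + C"
        using Z[OF that step(1)] C that by (intro add_mono mult_left_mono) auto
      finally show ?thesis .
    qed
    then show ?case by blast
  qed
  then have "\<exists>C. \<forall>\<alpha>\<in>Z. \<bar>rat_vec (axis i 1) \<bullet> real_vec \<alpha>\<bar> \<le> C" for i
    using assms(1) by blast
  then obtain C where C: "\<And>i \<alpha>. \<alpha> \<in> Z \<Longrightarrow> \<bar>real_of_int (\<alpha> $ i)\<bar> \<le> C i"
    by (simp add: rat_vec_axis inner_axis' real_vec_def) metis
  define k where "k = (\<Sum>i\<in>UNIV. \<bar>\<lceil>C i\<rceil>\<bar>)"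
  have "\<bar>\<alpha> $ i\<bar> \<le> k" if "\<alpha> \<in> Z" for \<alpha> i
  proof -
    have "\<bar>\<alpha> $ i\<bar> \<le> \<bar>\<lceil>C i\<rceil>\<bar>" using C[OF that, of i] by linarith
    also have "\<dots> \<le> k" unfolding k_def by (rule member_le_sum) auto
    finally show ?thesis .
  qed
  then have "Z \<subseteq> {\<alpha>. \<forall>i. \<bar>\<alpha> $ i\<bar> \<le> k}" by blast
  then show ?thesis using finite_integer_vectors_bounded by (rule finite_subset)
qed

section \<open>Series with polynomial weights\<close>

lemma non_zero_divisor_power: "non_zero_divisor a \<Longrightarrow> non_zero_divisor (a ^ n)"
  by (induction n) auto

lemma non_zero_divisor_prod:
  "(\<And>x. x \<in> A \<Longrightarrow> non_zero_divisor (f x)) \<Longrightarrow> non_zero_divisor (prod f A)"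
  by (induction A rule: infinite_finite_induct) auto

lemma laurent_act_one [simp]: "laurent_act 1 f = f"
  using laurent_act_single[of 0 1 f] by (simp add: single_one)

lemma laurent_act_uminus_right: "laurent_act q (\<lambda>\<alpha>. - f \<alpha>) = (\<lambda>\<alpha>. - laurent_act q f \<alpha>)"
  by (simp add: laurent_act_def sum_negf)

lemma series_represents_add:
  assumes "series_represents f F" "series_represents g G"
  shows "series_represents (\<lambda>\<alpha>. f \<alpha> + g \<alpha>) (F + G)"
proof -
  obtain p q where p: "non_zero_divisor q" "laurent_act q f = Poly_Mapping.lookup p"
      "F = TFract p q"
    using assms(1) by (auto simp: series_represents_def)
  obtain p' q' where p': "non_zero_divisor q'" "laurent_act q' g = Poly_Mapping.lookup p'"
      "G = TFract p' q'"
    using assms(2) by (auto simp: series_represents_def)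
  have "laurent_act (q * q') f = Poly_Mapping.lookup (q' * p)"
    by (subst mult.commute) (simp add: laurent_act_mult laurent_act_lookup p)
  moreover have "laurent_act (q * q') g = Poly_Mapping.lookup (q * p')"
    by (simp add: laurent_act_mult laurent_act_lookup p')
  ultimately have "laurent_act (q * q') (\<lambda>\<alpha>. f \<alpha> + g \<alpha>) = Poly_Mapping.lookup (p * q' + p' * q)"
    by (simp add: laurent_act_distrib_right fun_eq_iff Poly_Mapping.lookup_add mult.commute)
  then show ?thesis
    unfolding series_represents_def using p p'
    by (intro exI[of _ "p * q' + p' * q"] exI[of _ "q * q'"]) (simp add: add_TFract)
qed

lemma series_represents_uminus:
  assumes "series_represents f F"
  shows "series_represents (\<lambda>\<alpha>. - f \<alpha>) (- F)"
proof -
  obtain p q where p: "non_zero_divisor q" "laurent_act q f = Poly_Mapping.lookup p"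
      "F = TFract p q"
    using assms(1) by (auto simp: series_represents_def)
  then have "laurent_act q (\<lambda>\<alpha>. - f \<alpha>) = Poly_Mapping.lookup (- p)"
    by (simp add: laurent_act_uminus_right fun_eq_iff)
  then show ?thesis
    unfolding series_represents_def using p by (auto simp: uminus_TFract)
qed

text \<open>Nonzero series can thus represent the rational function \<open>0\<close>, which is how
  cones containing lines drop out.\<close>

lemma series_represents_zeroI:
  assumes "non_zero_divisor q" "laurent_act q f = (\<lambda>_. 0)"
  shows "series_represents f 0"
  unfolding series_represents_def
  by (rule exI[of _ 0], rule exI[of _ q]) (use assms in \<open>simp add: zero_tfrac_TFract TFract_eq_iff fun_eq_iff\<close>)

lemma series_represents_zero_zero: "series_represents (\<lambda>_. 0) 0"
  by (rule series_represents_zeroI[of 1]) auto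

lemma series_represents_sum:
  assumes "\<And>x. x \<in> A \<Longrightarrow> series_represents (f x) (F x)"
  shows "series_represents (\<lambda>\<alpha>. \<Sum>x\<in>A. f x \<alpha>) (\<Sum>x\<in>A. F x)"
  using assms
  by (induction A rule: infinite_finite_induct)
     (auto simp: series_represents_zero_zero intro: series_represents_add)

lemma series_represents_finite_support:
  assumes "non_zero_divisor q" "finite {\<alpha>. laurent_act q f \<alpha> \<noteq> 0}"
  shows "\<exists>F. series_represents f F"
  unfolding series_represents_def using assms
  by (intro exI[of _ "TFract (Abs_poly_mapping (laurent_act q f)) q"]
      exI[of _ "Abs_poly_mapping (laurent_act q f)"] exI[of _ q])
     (simp add: Abs_poly_mapping_inverse)

section \<open>Difference operators\<close>

definition diff_op :: "'b::ab_group_add \<Rightarrow> ('b \<Rightarrow> 'r::comm_ring_1) \<Rightarrow> 'b \<Rightarrow> 'r" where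
  "diff_op u c = (\<lambda>\<alpha>. c \<alpha> - c (\<alpha> - u))"

lemma diff_op_funpow_zero [simp]: "(diff_op u ^^ n) (\<lambda>_. 0) = (\<lambda>_. 0)"
  by (induction n) (auto simp: diff_op_def)

lemma diff_op_funpow_add:
  "(diff_op u ^^ n) (\<lambda>\<alpha>. c \<alpha> + d \<alpha>) = (\<lambda>\<alpha>. (diff_op u ^^ n) c \<alpha> + (diff_op u ^^ n) d \<alpha>)"
  by (induction n) (auto simp: diff_op_def fun_eq_iff)

lemma diff_op_funpow_scale:
  "(diff_op u ^^ n) (\<lambda>\<alpha>. k * c \<alpha>) = (\<lambda>\<alpha>. k * (diff_op u ^^ n) c \<alpha>)"
  by (induction n) (auto simp: diff_op_def fun_eq_iff algebra_simps)

text \<open>The iterated difference at \<alpha> only sees the points reached from \<alpha> by at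
  most \<open>n\<close> steps of \<open>- u\<close>. This allows an indicator function to be
  replaced by a constant away from its jump.\<close>

lemma diff_op_funpow_local:
  assumes "\<And>k. k \<le> n \<Longrightarrow> c (((\<lambda>\<beta>. \<beta> - u) ^^ k) \<alpha>) = d (((\<lambda>\<beta>. \<beta> - u) ^^ k) \<alpha>)"
  shows "(diff_op u ^^ n) c \<alpha> = (diff_op u ^^ n) d \<alpha>"
  using assms
proof (induction n arbitrary: \<alpha>)
  case 0
  show ?case using 0[of 0] by simp
next
  case (Suc n)
  have "(diff_op u ^^ n) c \<alpha> = (diff_op u ^^ n) d \<alpha>"
    using Suc.prems by (intro Suc.IH) auto
  moreover have "(diff_op u ^^ n) c (\<alpha> - u) = (diff_op u ^^ n) d (\<alpha> - u)"
  proof (rule Suc.IH)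
    fix k assume "k \<le> n"
    then show "c (((\<lambda>\<beta>. \<beta> - u) ^^ k) (\<alpha> - u)) = d (((\<lambda>\<beta>. \<beta> - u) ^^ k) (\<alpha> - u))"
      using Suc.prems[of "Suc k"] by (simp add: funpow_Suc_right del: funpow.simps)
  qed
  ultimately show ?case
    by (simp add: diff_op_def[of u "(diff_op u ^^ n) c"] diff_op_def[of u "(diff_op u ^^ n) d"])
qed

definition diff_nilpotent :: "'b::ab_group_add \<Rightarrow> ('b \<Rightarrow> 'r::comm_ring_1) \<Rightarrow> bool" where
  "diff_nilpotent u c \<longleftrightarrow> (\<exists>n. (diff_op u ^^ n) c = (\<lambda>_. 0))"

lemma diff_op_funpow_zero_mono:
  assumes "(diff_op u ^^ n) c = (\<lambda>_. 0)" "n \<le> m"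
  shows "(diff_op u ^^ m) c = (\<lambda>_. 0)"
proof -
  have "(diff_op u ^^ m) c = (diff_op u ^^ (m - n)) ((diff_op u ^^ n) c)"
    using assms(2) by (metis comp_apply funpow_add le_add_diff_inverse2)
  then show ?thesis using assms(1) by simp
qed

lemma diff_nilpotent_add:
  assumes "diff_nilpotent u c" "diff_nilpotent u d"
  shows "diff_nilpotent u (\<lambda>\<alpha>. c \<alpha> + d \<alpha>)"
proof -
  obtain n m where "(diff_op u ^^ n) c = (\<lambda>_. 0)" "(diff_op u ^^ m) d = (\<lambda>_. 0)"
    using assms by (auto simp: diff_nilpotent_def)
  then have "(diff_op u ^^ max n m) c = (\<lambda>_. 0)" "(diff_op u ^^ max n m) d = (\<lambda>_. 0)"
    by (auto intro: diff_op_funpow_zero_mono)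
  then show ?thesis unfolding diff_nilpotent_def
    by (intro exI[of _ "max n m"]) (simp add: diff_op_funpow_add)
qed

text \<open>Induction with the discrete Leibniz rule: the difference of a product is a sum of three
  products, each with at least one factor already differenced.\<close>

lemma diff_op_funpow_mult_zero:
  assumes "(diff_op u ^^ n) c = (\<lambda>_. 0)" "(diff_op u ^^ m) d = (\<lambda>_. 0)"
  shows "(diff_op u ^^ (n + m)) (\<lambda>\<alpha>. c \<alpha> * d \<alpha>) = (\<lambda>_. 0)"
  using assms
proof (induction "n + m" arbitrary: n m c d rule: less_induct)
  case less
  show ?case
  proof (cases "n = 0 \<or> m = 0")
    case True
    then have "(\<lambda>\<alpha>. c \<alpha> * d \<alpha>) = (\<lambda>_. 0)" using less.prems by auto
    then show ?thesis by simp
  next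
    case False
    then obtain n' m' where nm: "n = Suc n'" "m = Suc m'" by (metis not0_implies_Suc)
    have c: "(diff_op u ^^ n') (diff_op u c) = (\<lambda>_. 0)" and d: "(diff_op u ^^ m') (diff_op u d) = (\<lambda>_. 0)"
      using less.prems unfolding nm by (simp_all add: funpow_swap1)
    have 1: "(diff_op u ^^ (n' + m)) (\<lambda>\<alpha>. diff_op u c \<alpha> * d \<alpha>) = (\<lambda>_. 0)"
      using nm c less.prems by (intro less.hyps) auto
    have 2: "(diff_op u ^^ (n + m')) (\<lambda>\<alpha>. c \<alpha> * diff_op u d \<alpha>) = (\<lambda>_. 0)"
      using nm d less.prems by (intro less.hyps) auto
    \<comment> \<open>The cross term already dies after \<open>n' + m'\<close> steps; one more
      aligns it with the other two terms, since \<open>n + m' = n' + m\<close>.\<close>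
    have "(diff_op u ^^ (n + m')) (\<lambda>\<alpha>. (- 1) * (diff_op u c \<alpha> * diff_op u d \<alpha>)) = (\<lambda>_. 0)"
      unfolding diff_op_funpow_scale
      using less.hyps[OF _ c d] nm by (subst diff_op_funpow_zero_mono[of "n' + m'"]) auto
    moreover have "diff_op u (\<lambda>\<alpha>. c \<alpha> * d \<alpha>)
        = (\<lambda>\<alpha>. diff_op u c \<alpha> * d \<alpha> + (c \<alpha> * diff_op u d \<alpha> + (- 1) * (diff_op u c \<alpha> * diff_op u d \<alpha>)))"
      by (simp add: diff_op_def fun_eq_iff algebra_simps)
    ultimately have "(diff_op u ^^ (n' + m)) (diff_op u (\<lambda>\<alpha>. c \<alpha> * d \<alpha>)) = (\<lambda>_. 0)"
      using 1 2 nm by (simp only: diff_op_funpow_add) simp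
    then show ?thesis using nm by (simp add: funpow_swap1)
  qed
qed

lemma diff_nilpotent_mult:
  "diff_nilpotent u c \<Longrightarrow> diff_nilpotent u d \<Longrightarrow> diff_nilpotent u (\<lambda>\<alpha>. c \<alpha> * d \<alpha>)"
  unfolding diff_nilpotent_def by (blast intro: diff_op_funpow_mult_zero)

lemma diff_nilpotent_const: "diff_nilpotent u (\<lambda>_. k)"
  unfolding diff_nilpotent_def by (rule exI[of _ 1]) (simp add: diff_op_def)

lemma diff_nilpotent_power: "diff_nilpotent u c \<Longrightarrow> diff_nilpotent u (\<lambda>\<alpha>. c \<alpha> ^ n)"
  by (induction n) (auto intro: diff_nilpotent_mult diff_nilpotent_const)

lemma diff_nilpotent_prod:
  "(\<And>x. x \<in> A \<Longrightarrow> diff_nilpotent u (c x)) \<Longrightarrow> diff_nilpotent u (\<lambda>\<alpha>. \<Prod>x\<in>A. c x \<alpha>)"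
  by (induction A rule: infinite_finite_induct) (auto intro: diff_nilpotent_mult diff_nilpotent_const)

lemma diff_nilpotent_sum:
  "(\<And>x. x \<in> A \<Longrightarrow> diff_nilpotent u (c x)) \<Longrightarrow> diff_nilpotent u (\<lambda>\<alpha>. \<Sum>x\<in>A. c x \<alpha>)"
  by (induction A rule: infinite_finite_induct) (auto intro: diff_nilpotent_add diff_nilpotent_const)

text \<open>A coordinate has constant first difference, hence zero second difference. Polynomials
  arise from coordinates and constants by sums and products.\<close>

lemma diff_nilpotent_poly_eval:
  fixes w :: "('d::finite \<Rightarrow>\<^sub>0 nat) \<Rightarrow>\<^sub>0 'r::comm_ring_1"
  shows "diff_nilpotent u (poly_eval w)"
proof -
  have "diff_nilpotent u (\<lambda>\<alpha>. of_int (\<alpha> $ i) :: 'r)" for i :: 'd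
    unfolding diff_nilpotent_def by (rule exI[of _ 2]) (simp add: diff_op_def numeral_2_eq_2 fun_eq_iff)
  then show ?thesis unfolding poly_eval_def[abs_def]
    by (intro diff_nilpotent_sum diff_nilpotent_mult diff_nilpotent_const diff_nilpotent_prod diff_nilpotent_power)
qed

section \<open>Binomial factors and simplicial cones\<close>

definition binomial_factor :: "(int ^ 'd::finite \<Rightarrow> 'g::ab_group_add) \<Rightarrow> int ^ 'd \<Rightarrow>
    ('d, ('g, 'r::comm_ring_1) group_ring) laurent_poly" where
  "binomial_factor \<phi> u = 1 - Poly_Mapping.single u (Poly_Mapping.single (\<phi> u) 1)"

lemma laurent_act_binomial_factor:
  fixes f :: "('d::finite, ('g::ab_group_add, 'r::comm_ring_1) group_ring) formal_series"
  shows "laurent_act (binomial_factor \<phi> u) f = (\<lambda>\<alpha>. f \<alpha> - Poly_Mapping.single (\<phi> u) 1 * f (\<alpha> - u))"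
proof -
  have "(binomial_factor \<phi> u :: ('d, ('g, 'r) group_ring) laurent_poly) = Poly_Mapping.single 0 1 + Poly_Mapping.single u (- Poly_Mapping.single (\<phi> u) 1)"
    by (simp add: binomial_factor_def single_one single_uminus)
  then show ?thesis by (simp only: laurent_act_add laurent_act_single) simp
qed

text \<open>If the product with \<open>x\<close> vanishes, a monomial of \<open>x\<close> at
  \<alpha> forces one at \<open>\<alpha> - u\<close>, and so at all \<open>\<alpha> - k u\<close>.
  These are infinitely many exponents because \<open>u\<close> is nonzero.\<close>

lemma non_zero_divisor_binomial_factor:
  fixes \<phi> :: "int ^ 'd::finite \<Rightarrow> 'g::ab_group_add" and u :: "int ^ 'd"
  assumes "u \<noteq> 0"
  shows "non_zero_divisor (binomial_factor \<phi> u :: ('d, ('g, 'r::comm_ring_1) group_ring) laurent_poly)"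
  unfolding non_zero_divisor_def
proof (intro allI impI)
  fix x :: "('d, ('g, 'r) group_ring) laurent_poly"
  assume "binomial_factor \<phi> u * x = 0"
  then have "laurent_act (binomial_factor \<phi> u) (Poly_Mapping.lookup x) = (\<lambda>_. 0)"
    by (simp add: laurent_act_lookup fun_eq_iff)
  then have "laurent_act (binomial_factor \<phi> u) (Poly_Mapping.lookup x) \<alpha> = 0" for \<alpha>
    by (rule fun_cong)
  then have rec: "Poly_Mapping.lookup x \<alpha> = Poly_Mapping.single (\<phi> u) 1 * Poly_Mapping.lookup x (\<alpha> - u)" for \<alpha>
    unfolding laurent_act_binomial_factor right_minus_eq .
  show "x = 0"
  proof (rule ccontr)
    assume "x \<noteq> 0"
    then obtain \<alpha> where \<alpha>: "\<alpha> \<in> Poly_Mapping.keys x"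
      by (metis Poly_Mapping.keys_eq_empty ex_in_conv)
    have "\<alpha> - of_nat k *s u \<in> Poly_Mapping.keys x" for k
    proof (induction k)
      case (Suc k)
      then have "Poly_Mapping.lookup x (\<alpha> - of_nat k *s u - u) \<noteq> 0"
        using rec[of "\<alpha> - of_nat k *s u"] by (metis Poly_Mapping.in_keys_iff mult_zero_right)
      moreover have "\<alpha> - of_nat k *s u - u = \<alpha> - of_nat (Suc k) *s u"
        by (simp add: vec_eq_iff algebra_simps)
      ultimately show ?case by (simp add: Poly_Mapping.in_keys_iff)
    qed (use \<alpha> in simp)
    then have "range (\<lambda>k::nat. \<alpha> - of_nat k *s u) \<subseteq> Poly_Mapping.keys x" by auto
    then have "finite (range (\<lambda>k::nat. \<alpha> - of_nat k *s u))"
      by (rule finite_subset) simp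
    moreover have "inj (\<lambda>k::nat. \<alpha> - of_nat k *s u)"
      using assms by (auto simp: inj_on_def vec_eq_iff)
    ultimately show False using finite_imageD infinite_UNIV_nat by blast
  qed
qed

text \<open>The twist by \<open>\<phi> u\<close> in the factor compensates the change from
  \<open>\<phi> (\<alpha> - u)\<close> to \<open>\<phi> \<alpha>\<close>, so only an ordinary
  difference of the coefficients remains.\<close>

lemma laurent_act_binomial_factor_power:
  fixes \<phi> :: "int ^ 'd::finite \<Rightarrow> 'g::ab_group_add" and c :: "int ^ 'd \<Rightarrow> 'r::comm_ring_1"
  assumes hom: "\<And>\<alpha> \<beta>. \<phi> (\<alpha> + \<beta>) = \<phi> \<alpha> + \<phi> \<beta>"
  shows "laurent_act (binomial_factor \<phi> u ^ n) (\<lambda>\<alpha>. Poly_Mapping.single (\<phi> \<alpha>) (c \<alpha>))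
    = (\<lambda>\<alpha>. Poly_Mapping.single (\<phi> \<alpha>) ((diff_op u ^^ n) c \<alpha>))"
proof (induction n)
  case (Suc n)
  have "\<phi> u + \<phi> (\<alpha> - u) = \<phi> \<alpha>" for \<alpha>
    using hom[of u "\<alpha> - u"] by simp
  then show ?case
    by (simp add: laurent_act_mult Suc.IH laurent_act_binomial_factor mult_single single_diff diff_op_def)
qed simp

lemma series_represents_zero_of_diff_nilpotent:
  fixes \<phi> :: "int ^ 'd::finite \<Rightarrow> 'g::ab_group_add" and c :: "int ^ 'd \<Rightarrow> 'r::comm_ring_1"
  assumes "\<And>\<alpha> \<beta>. \<phi> (\<alpha> + \<beta>) = \<phi> \<alpha> + \<phi> \<beta>" "u \<noteq> 0" "diff_nilpotent u c"
  shows "series_represents (\<lambda>\<alpha>. Poly_Mapping.single (\<phi> \<alpha>) (c \<alpha>)) 0"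
proof -
  obtain n where "(diff_op u ^^ n) c = (\<lambda>_. 0)" using assms(3) by (auto simp: diff_nilpotent_def)
  then show ?thesis
    by (intro series_represents_zeroI[of "binomial_factor \<phi> u ^ n"] non_zero_divisor_power
        non_zero_divisor_binomial_factor assms(2))
       (simp add: laurent_act_binomial_factor_power[OF assms(1)])
qed

text \<open>Once one factor has confined the support to \<open>Z\<close>, this closure property,
  stable under products, guarantees that the remaining factors do not enlarge it.\<close>

definition preserves_support ::
    "(int ^ 'd::finite) set \<Rightarrow> ('d, 'a::comm_ring_1) laurent_poly \<Rightarrow> bool" where
  "preserves_support Z q \<longleftrightarrow>
     (\<forall>f. (\<forall>\<alpha>. \<alpha> \<notin> Z \<longrightarrow> f \<alpha> = 0) \<longrightarrow> (\<forall>\<alpha>. \<alpha> \<notin> Z \<longrightarrow> laurent_act q f \<alpha> = 0))"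

lemma preserves_support_mult:
  "preserves_support Z p \<Longrightarrow> preserves_support Z q \<Longrightarrow> preserves_support Z (p * q)"
  by (simp add: preserves_support_def laurent_act_mult)

lemma preserves_support_one: "preserves_support Z 1"
  by (simp add: preserves_support_def)

lemma preserves_support_power: "preserves_support Z q \<Longrightarrow> preserves_support Z (q ^ n)"
  by (induction n) (auto intro: preserves_support_mult preserves_support_one)

lemma preserves_support_prod:
  "(\<And>x. x \<in> A \<Longrightarrow> preserves_support Z (q x)) \<Longrightarrow> preserves_support Z (prod q A)"
  by (induction A rule: infinite_finite_induct) (auto intro: preserves_support_mult preserves_support_one)

lemma preserves_support_binomial_factor:
  "(\<And>\<alpha>. \<alpha> \<notin> Z \<Longrightarrow> \<alpha> - u \<notin> Z) \<Longrightarrow> preserves_support Z (binomial_factor \<phi> u)"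
  by (simp add: preserves_support_def laurent_act_binomial_factor)

text \<open>The vectors dual to the normals are the ray directions. The factor for the ray
  \<open>u a\<close> confines the support to a strip along the facet of \<open>a\<close>, the other
  factors preserve that strip, and the strips of all facets meet in finitely many integer
  points.\<close>

lemma simplicial_cone_representable:
  fixes A :: "(rat ^ 'd::finite) set" and c :: "int ^ 'd \<Rightarrow> 'r::comm_ring_1"
    and \<phi> :: "int ^ 'd \<Rightarrow> 'g::ab_group_add" and v :: "real ^ 'd"
  assumes hom: "\<And>\<alpha> \<beta>. \<phi> (\<alpha> + \<beta>) = \<phi> \<alpha> + \<phi> \<beta>"
    and indep: "vec.independent A" and span: "vec.span A = UNIV"
    and c: "\<And>u. diff_nilpotent u c"
  defines "F \<equiv> \<lambda>\<alpha>. \<Prod>a\<in>A. if rat_vec a \<bullet> (real_vec \<alpha> - v) \<ge> 0 then 1 else 0 :: int"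
  shows "\<exists>f. series_represents (\<lambda>\<alpha>. Poly_Mapping.single (\<phi> \<alpha>) (of_int (F \<alpha>) * c \<alpha>)) f"
proof -
  have fin: "finite A" using indep by (rule vec.finiteI_independent)
  obtain u where u: "\<And>a. a \<in> A \<Longrightarrow> rat_vec a \<bullet> real_vec (u a) > 0"
    "\<And>a b. a \<in> A \<Longrightarrow> b \<in> A \<Longrightarrow> a \<noteq> b \<Longrightarrow> rat_vec a \<bullet> real_vec (u b) = 0"
    using rational_dual_vectors[OF indep] by blast
  define n where "n a = (SOME n. (diff_op (u a) ^^ n) c = (\<lambda>_. 0))" for a
  have n: "(diff_op (u a) ^^ n a) c = (\<lambda>_. 0)" for a
    unfolding n_def using c[of "u a"] unfolding diff_nilpotent_def by (rule someI_ex)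
  \<comment> \<open>The strip is as wide as \<open>n a\<close> steps of \<open>u a\<close>, so that
    from beyond it none of these steps crosses the facet.\<close>
  define Z where "Z a = {\<alpha>. 0 \<le> rat_vec a \<bullet> (real_vec \<alpha> - v) \<and>
      rat_vec a \<bullet> (real_vec \<alpha> - v) \<le> of_nat (n a) * (rat_vec a \<bullet> real_vec (u a))}" for a
  define q :: "('d, ('g, 'r) group_ring) laurent_poly"
    where "q = (\<Prod>a\<in>A. binomial_factor \<phi> (u a) ^ n a)"
  define s where "s = (\<lambda>\<alpha>. Poly_Mapping.single (\<phi> \<alpha>) (of_int (F \<alpha>) * c \<alpha>))"
  have shift: "rat_vec b \<bullet> (real_vec (((\<lambda>\<beta>. \<beta> - u a) ^^ k) \<alpha>) - v)
      = rat_vec b \<bullet> (real_vec \<alpha> - v) - of_nat k * (rat_vec b \<bullet> real_vec (u a))" for a b k \<alpha>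
    by (induction k) (auto simp: real_vec_diff inner_diff_right algebra_simps)
  have outside: "(diff_op (u a) ^^ n a) (\<lambda>\<alpha>. of_int (F \<alpha>) * c \<alpha>) \<alpha> = 0"
    if a: "a \<in> A" and \<alpha>: "\<alpha> \<notin> Z a" for a \<alpha>
  proof -
    have other: "rat_vec b \<bullet> (real_vec (((\<lambda>\<beta>. \<beta> - u a) ^^ k) \<alpha>) - v) = rat_vec b \<bullet> (real_vec \<alpha> - v)"
      if "b \<in> A" "b \<noteq> a" for b k
      using u(2)[OF that(1) a that(2)] by (simp add: shift)
    consider "rat_vec a \<bullet> (real_vec \<alpha> - v) < 0"
      | "rat_vec a \<bullet> (real_vec \<alpha> - v) > of_nat (n a) * (rat_vec a \<bullet> real_vec (u a))"
      using \<alpha> unfolding Z_def by fastforce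
    then show ?thesis
    proof cases
      case 1
      \<comment> \<open>Steps of \<open>- u a\<close> lead further away from the halfspace, so the
        indicator is zero at all points involved.\<close>
      have "rat_vec a \<bullet> (real_vec (((\<lambda>\<beta>. \<beta> - u a) ^^ k) \<alpha>) - v) < 0" for k
        unfolding shift using 1 u(1)[OF a] by (smt (verit) mult_nonneg_nonneg of_nat_0_le_iff)
      then have "F (((\<lambda>\<beta>. \<beta> - u a) ^^ k) \<alpha>) = 0" for k
        unfolding F_def using fin a by (intro prod_zero) (auto simp: not_le)
      then have "(diff_op (u a) ^^ n a) (\<lambda>\<alpha>. of_int (F \<alpha>) * c \<alpha>) \<alpha> = (diff_op (u a) ^^ n a) (\<lambda>_. 0) \<alpha>"
        by (intro diff_op_funpow_local) simp
      then show ?thesis by simp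
    next
      case 2
      have "0 \<le> rat_vec a \<bullet> (real_vec (((\<lambda>\<beta>. \<beta> - u a) ^^ k) \<alpha>) - v)" if "k \<le> n a" for k
      proof -
        have "real k * (rat_vec a \<bullet> real_vec (u a)) \<le> real (n a) * (rat_vec a \<bullet> real_vec (u a))"
          using that u(1)[OF a] by (intro mult_right_mono) auto
        then show ?thesis unfolding shift using 2 by linarith
      qed
      moreover have "0 \<le> rat_vec a \<bullet> (real_vec \<alpha> - v)" using calculation[of 0] by simp
      \<comment> \<open>The indicator is constant on the points involved, so it factors out and the
        nilpotency of \<open>c\<close> applies.\<close>
      ultimately have "F (((\<lambda>\<beta>. \<beta> - u a) ^^ k) \<alpha>) = F \<alpha>" if "k \<le> n a" for k
        unfolding F_def using other that by (intro prod.cong refl) metis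
      then have "(diff_op (u a) ^^ n a) (\<lambda>\<alpha>. of_int (F \<alpha>) * c \<alpha>) \<alpha>
          = (diff_op (u a) ^^ n a) (\<lambda>\<beta>. of_int (F \<alpha>) * c \<beta>) \<alpha>"
        by (intro diff_op_funpow_local) simp
      then show ?thesis by (simp add: diff_op_funpow_scale n)
    qed
  qed
  have "laurent_act q s \<alpha> = 0" if a: "a \<in> A" and \<alpha>: "\<alpha> \<notin> Z a" for a \<alpha>
  proof -
    \<comment> \<open>For \<open>b\<close> other than \<open>a\<close>, translation by
      \<open>u b\<close> is parallel to the facet of \<open>a\<close>.\<close>
    have "preserves_support (Z a) (\<Prod>b\<in>A - {a}. binomial_factor \<phi> (u b) ^ n b :: ('d, ('g, 'r) group_ring) laurent_poly)"
    proof (intro preserves_support_prod preserves_support_power preserves_support_binomial_factor)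
      fix b \<alpha> assume "b \<in> A - {a}" "\<alpha> \<notin> Z a"
      then show "\<alpha> - u b \<notin> Z a"
        using u(2)[of a b] a by (auto simp: Z_def real_vec_diff inner_diff_right)
    qed
    moreover have "laurent_act (binomial_factor \<phi> (u a) ^ n a) s \<beta> = 0" if "\<beta> \<notin> Z a" for \<beta>
      unfolding s_def laurent_act_binomial_factor_power[OF hom] outside[OF a that] by simp
    moreover have "q = (\<Prod>b\<in>A - {a}. binomial_factor \<phi> (u b) ^ n b) * binomial_factor \<phi> (u a) ^ n a"
      unfolding q_def using fin a by (subst prod.remove[of _ a]) (auto simp: mult.commute)
    ultimately show ?thesis
      using \<alpha> by (simp add: laurent_act_mult preserves_support_def)
  qed
  then have "{\<alpha>. laurent_act q s \<alpha> \<noteq> 0} \<subseteq> (\<Inter>a\<in>A. Z a)" by blast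
  moreover have "finite (\<Inter>a\<in>A. Z a)"
  proof (rule finite_integer_parallelepiped[OF span])
    fix \<alpha> a assume "\<alpha> \<in> (\<Inter>a\<in>A. Z a)" "a \<in> A"
    then have "\<alpha> \<in> Z a" by blast
    then show "\<bar>rat_vec a \<bullet> real_vec \<alpha>\<bar> \<le> \<bar>rat_vec a \<bullet> v\<bar> + of_nat (n a) * (rat_vec a \<bullet> real_vec (u a))"
      unfolding Z_def inner_diff_right mem_Collect_eq by linarith
  qed
  ultimately have "finite {\<alpha>. laurent_act q s \<alpha> \<noteq> 0}" by (rule finite_subset)
  moreover have "non_zero_divisor q"
    unfolding q_def using u(1)
    by (intro non_zero_divisor_prod non_zero_divisor_power non_zero_divisor_binomial_factor) force
  ultimately show ?thesis
    unfolding s_def[symmetric] by (intro series_represents_finite_support)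
qed

section \<open>Rational polytopes as intersections of halfspaces\<close>

text \<open>Positive \<open>\<beta> e\<close> give lower bounds for \<open>r\<close>, negative ones
  upper bounds. A suitable \<open>r\<close> exists iff no lower bound exceeds an upper bound; the
  products are this comparison with denominators cleared.\<close>

lemma Fourier_Motzkin_step:
  fixes \<alpha> \<beta> :: "'e \<Rightarrow> real"
  assumes fin: "finite E"
  shows "(\<exists>r. \<forall>e\<in>E. 0 \<le> \<alpha> e + r * \<beta> e) \<longleftrightarrow>
    (\<forall>e\<in>E. \<beta> e = 0 \<longrightarrow> 0 \<le> \<alpha> e) \<and>
    (\<forall>e\<in>E. \<forall>e'\<in>E. 0 < \<beta> e \<longrightarrow> \<beta> e' < 0 \<longrightarrow> 0 \<le> \<beta> e * \<alpha> e' - \<beta> e' * \<alpha> e)"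
    (is "?L \<longleftrightarrow> ?R")
proof
  assume ?L
  then obtain r where r: "\<And>e. e \<in> E \<Longrightarrow> 0 \<le> \<alpha> e + r * \<beta> e" by blast
  have "0 \<le> \<beta> e * \<alpha> e' - \<beta> e' * \<alpha> e" if "e \<in> E" "e' \<in> E" "0 < \<beta> e" "\<beta> e' < 0" for e e'
  proof -
    have "0 \<le> \<beta> e * (\<alpha> e' + r * \<beta> e') + (- \<beta> e') * (\<alpha> e + r * \<beta> e)"
      by (rule add_nonneg_nonneg; rule mult_nonneg_nonneg)
         (use r[OF that(1)] r[OF that(2)] that(3,4) in auto)
    then show ?thesis by (simp add: algebra_simps)
  qed
  moreover have "0 \<le> \<alpha> e" if "e \<in> E" "\<beta> e = 0" for e using r[OF that(1)] that(2) by simp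
  ultimately show ?R by blast
next
  assume R: ?R
  define L where "L = (\<lambda>e. - \<alpha> e / \<beta> e) ` {e\<in>E. 0 < \<beta> e}"
  define U where "U = (\<lambda>e. - \<alpha> e / \<beta> e) ` {e\<in>E. \<beta> e < 0}"
  have finLU: "finite L" "finite U" using fin by (auto simp: L_def U_def)
  have "l \<le> u" if "l \<in> L" "u \<in> U" for l u
    using that R by (auto simp: L_def U_def field_simps)
  then obtain r where r: "\<And>l. l \<in> L \<Longrightarrow> l \<le> r" "\<And>u. u \<in> U \<Longrightarrow> r \<le> u"
  proof -
    assume LU: "\<And>l u. l \<in> L \<Longrightarrow> u \<in> U \<Longrightarrow> l \<le> u"
      and that: "\<And>r. (\<And>l. l \<in> L \<Longrightarrow> l \<le> r) \<Longrightarrow> (\<And>u. u \<in> U \<Longrightarrow> r \<le> u) \<Longrightarrow> thesis"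
    show thesis
    proof (cases "L = {}")
      case True
      show ?thesis
        by (rule that[of "if U = {} then 0 else Min U"]) (use True finLU in \<open>auto\<close>)
    next
      case False
      show ?thesis
        by (rule that[of "Max L"]) (use False finLU LU in auto)
    qed
  qed
  have "0 \<le> \<alpha> e + r * \<beta> e" if e: "e \<in> E" for e
  proof -
    consider "\<beta> e = 0" | "0 < \<beta> e" | "\<beta> e < 0" by linarith
    then show ?thesis
    proof cases
      case 1
      then show ?thesis using R e by simp
    next
      case 2
      then have "- \<alpha> e / \<beta> e \<le> r" using e by (intro r) (auto simp: L_def)
      then show ?thesis using 2 by (simp add: field_simps)
    next
      case 3
      then have "r \<le> - \<alpha> e / \<beta> e" using e by (intro r) (auto simp: U_def)
      then show ?thesis using 3 by (simp add: field_simps)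
    qed
  qed
  then show ?L by blast
qed

text \<open>The multipliers in the elimination are the coefficients of \<open>r\<close>, so the new
  inequalities stay rational although \<open>x\<close> and \<open>r\<close> range over the
  reals.\<close>

lemma rational_Fourier_Motzkin:
  fixes E :: "((rat ^ 'd::finite) \<times> rat \<times> rat) set"
  assumes fin: "finite E"
  obtains I :: "((rat ^ 'd) \<times> rat) set" where "finite I"
    "\<And>x. (\<exists>r. \<forall>(a, b, \<beta>)\<in>E. 0 \<le> rat_vec a \<bullet> x + of_rat b + r * of_rat \<beta>)
      \<longleftrightarrow> (\<forall>(a, b)\<in>I. 0 \<le> rat_vec a \<bullet> x + of_rat b)"
proof
  let ?f = "\<lambda>p. (snd (snd (fst p)) *s fst (snd p) - snd (snd (snd p)) *s fst (fst p),
    snd (snd (fst p)) * fst (snd (snd p)) - snd (snd (snd p)) * fst (snd (fst p)))"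
  let ?S = "{(e, e') \<in> E \<times> E. 0 < snd (snd e) \<and> snd (snd e') < 0}"
  let ?I = "(\<lambda>e. (fst e, fst (snd e))) ` {e \<in> E. snd (snd e) = 0} \<union> ?f ` ?S"
  have "finite ?S" by (rule finite_subset[of _ "E \<times> E"]) (use fin in auto)
  then show "finite ?I" using fin by simp
  fix x :: "real ^ 'd"
  let ?\<alpha> = "\<lambda>e. rat_vec (fst e) \<bullet> x + of_rat (fst (snd e))"
  let ?\<beta> = "\<lambda>e. real_of_rat (snd (snd e))"
  have "(\<exists>r. \<forall>(a, b, \<beta>)\<in>E. 0 \<le> rat_vec a \<bullet> x + of_rat b + r * of_rat \<beta>)
      \<longleftrightarrow> (\<exists>r. \<forall>e\<in>E. 0 \<le> ?\<alpha> e + r * ?\<beta> e)"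
    by (simp add: case_prod_unfold)
  also have "\<dots> \<longleftrightarrow> (\<forall>e\<in>E. ?\<beta> e = 0 \<longrightarrow> 0 \<le> ?\<alpha> e) \<and>
    (\<forall>e\<in>E. \<forall>e'\<in>E. 0 < ?\<beta> e \<longrightarrow> ?\<beta> e' < 0 \<longrightarrow> 0 \<le> ?\<beta> e * ?\<alpha> e' - ?\<beta> e' * ?\<alpha> e)"
    by (rule Fourier_Motzkin_step[OF fin])
  also have "(\<forall>e\<in>E. ?\<beta> e = 0 \<longrightarrow> 0 \<le> ?\<alpha> e) \<longleftrightarrow>
      (\<forall>(a, b)\<in>(\<lambda>e. (fst e, fst (snd e))) ` {e \<in> E. snd (snd e) = 0}. 0 \<le> rat_vec a \<bullet> x + of_rat b)"
    by auto
  also have "(\<forall>e\<in>E. \<forall>e'\<in>E. 0 < ?\<beta> e \<longrightarrow> ?\<beta> e' < 0 \<longrightarrow> 0 \<le> ?\<beta> e * ?\<alpha> e' - ?\<beta> e' * ?\<alpha> e) \<longleftrightarrow>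
      (\<forall>(a, b)\<in>?f ` ?S. 0 \<le> rat_vec a \<bullet> x + of_rat b)"
  proof -
    have key: "?\<beta> e * ?\<alpha> e' - ?\<beta> e' * ?\<alpha> e = rat_vec (fst (?f (e, e'))) \<bullet> x + of_rat (snd (?f (e, e')))" for e e' :: "(rat ^ 'd) \<times> rat \<times> rat"
      by (simp add: case_prod_unfold rat_vec_diff rat_vec_scale inner_diff_left of_rat_diff of_rat_mult algebra_simps)
    have gen: "(\<forall>e\<in>E. \<forall>e'\<in>E. 0 < ?\<beta> e \<longrightarrow> ?\<beta> e' < 0 \<longrightarrow> Q (e, e')) \<longleftrightarrow> (\<forall>p\<in>?S. Q p)" for Q
      by auto
    show ?thesis
      unfolding key gen[of "\<lambda>p. 0 \<le> rat_vec (fst (?f p)) \<bullet> x + of_rat (snd (?f p))"]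
      by (simp only: ball_simps case_prod_conv fst_conv snd_conv)
  qed
  finally show "(\<exists>r. \<forall>(a, b, \<beta>)\<in>E. 0 \<le> rat_vec a \<bullet> x + of_rat b + r * of_rat \<beta>)
      \<longleftrightarrow> (\<forall>(a, b)\<in>?I. 0 \<le> rat_vec a \<bullet> x + of_rat b)"
    by (simp only: ball_Un)
qed

text \<open>Add the points one at a time. A point of the enlarged hull lies in the image of the old
  hull under a homothety with centre \<open>rat_vec s\<close> and ratio \<open>r\<close> in the unit
  interval. Homogenizing the inequalities makes them linear in \<open>x\<close> and \<open>r\<close>
  jointly, and \<open>r\<close> can be eliminated.\<close>

lemma rational_convex_hull_halfspaces:
  fixes S :: "(rat ^ 'd::finite) set"
  assumes "finite S"
  shows "\<exists>I :: ((rat ^ 'd) \<times> rat) set. finite I \<and>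
    convex hull (rat_vec ` S) = {x. \<forall>(a, b)\<in>I. 0 \<le> rat_vec a \<bullet> x + of_rat b}"
  using assms
proof (induction S rule: finite_induct)
  case empty
  \<comment> \<open>The contradictory inequality \<open>0 \<le> - 1\<close> describes the empty
    hull.\<close>
  show ?case by (rule exI[of _ "{(0, - 1)}"]) simp
next
  case (insert s S)
  then obtain I where finI: "finite I"
    and I: "convex hull (rat_vec ` S) = {x. \<forall>(a, b)\<in>I. 0 \<le> rat_vec a \<bullet> x + of_rat b}" by blast
  show ?case
  proof (cases "S = {}")
    case True
    let ?I = "range (\<lambda>i. (axis i 1, - s $ i)) \<union> range (\<lambda>i. (- axis i 1, s $ i))"
    have "{x. \<forall>(a, b)\<in>?I. 0 \<le> rat_vec a \<bullet> x + of_rat b} = {rat_vec s}"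
      by (auto simp: rat_vec_minus rat_vec_axis inner_axis' of_rat_minus ball_Un vec_eq_iff rat_vec_def[of s]) (meson order_antisym)
    then show ?thesis using True by (intro exI[of _ ?I]) simp
  next
    case False
    define ev where "ev a b = (\<Sum>i\<in>UNIV. a $ i * s $ i) + b" for a :: "rat ^ 'd" and b
    \<comment> \<open>The first two triples encode \<open>0 \<le> r\<close> and
      \<open>r \<le> 1\<close>; the rest are the homogenized inequalities of
      \<open>I\<close>.\<close>
    define E where "E = insert (0, 0, 1) (insert (0, 1, - 1)
        ((\<lambda>(a, b). (a, - (\<Sum>i\<in>UNIV. a $ i * s $ i), ev a b)) ` I))"
    have ev: "of_rat (ev a b) = rat_vec a \<bullet> rat_vec s + of_rat b" for a b
      by (simp add: ev_def of_rat_add rat_vec_inner_rat_vec)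
    have E: "(\<forall>(a, b, \<beta>)\<in>E. 0 \<le> rat_vec a \<bullet> x + of_rat b + r * of_rat \<beta>) \<longleftrightarrow>
        0 \<le> r \<and> r \<le> 1 \<and> (\<forall>(a, b)\<in>I. 0 \<le> rat_vec a \<bullet> (x - rat_vec s) + r * (rat_vec a \<bullet> rat_vec s + of_rat b))" for x r
      by (simp add: E_def case_prod_unfold ev of_rat_minus inner_diff_right flip: rat_vec_inner_rat_vec)
    obtain q0 where q0: "q0 \<in> convex hull (rat_vec ` S)" using False hull_subset[of "rat_vec ` S" convex] by blast
    have "bounded (convex hull (rat_vec ` S))"
      using insert.hyps by (intro bounded_convex_hull finite_imp_bounded) auto
    then obtain C where C: "\<And>q. q \<in> convex hull (rat_vec ` S) \<Longrightarrow> norm q \<le> C"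
      by (auto simp: bounded_iff)
    \<comment> \<open>Boundedness excludes nonzero recession directions, so the parameter value \<open>r = 0\<close> only
      contributes the new point.\<close>
    have recession: "y = 0" if y: "\<forall>(a, b)\<in>I. 0 \<le> rat_vec a \<bullet> y" for y
    proof (rule ccontr)
      assume "y \<noteq> 0"
      have "norm (q0 + k *\<^sub>R y) \<le> C" if "k \<ge> 0" for k
      proof (rule C)
        have "0 \<le> rat_vec a \<bullet> (q0 + k *\<^sub>R y) + of_rat b" if ab: "(a, b) \<in> I" for a b
        proof -
          have "0 \<le> k * (rat_vec a \<bullet> y)" using y ab \<open>k \<ge> 0\<close> by auto
          moreover have "0 \<le> rat_vec a \<bullet> q0 + of_rat b" using q0 ab I by auto
          ultimately show ?thesis by (simp add: inner_add_right)
        qed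
        then show "q0 + k *\<^sub>R y \<in> convex hull (rat_vec ` S)" unfolding I by auto
      qed
      note unbounded = this
      have Cpos: "C + norm q0 + 1 > 0" using C[OF q0] norm_ge_zero[of q0] by linarith
      \<comment> \<open>This multiple of \<open>y\<close> has norm \<open>C + norm q0 + 1\<close>,
        too long for adding \<open>q0\<close> to bring it back into the ball of radius
        \<open>C\<close>.\<close>
      from unbounded[of "(C + norm q0 + 1) / norm y"]
      have "norm (q0 + ((C + norm q0 + 1) / norm y) *\<^sub>R y) \<le> C"
        using Cpos by (simp add: divide_nonneg_nonneg)
      moreover have "norm (((C + norm q0 + 1) / norm y) *\<^sub>R y) = C + norm q0 + 1"
        using Cpos \<open>y \<noteq> 0\<close> by simp
      ultimately show False
        using norm_diff_ineq[of "((C + norm q0 + 1) / norm y) *\<^sub>R y" q0] by (simp add: add.commute)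
    qed
    have hull: "x \<in> convex hull (rat_vec ` insert s S) \<longleftrightarrow>
        (\<exists>r. \<forall>(a, b, \<beta>)\<in>E. 0 \<le> rat_vec a \<bullet> x + of_rat b + r * of_rat \<beta>)" (is "?L \<longleftrightarrow> ?R") for x
    proof
      assume ?L
      then obtain r q where r: "0 \<le> r" "r \<le> 1" and q: "q \<in> convex hull (rat_vec ` S)"
        and x: "x = (1 - r) *\<^sub>R rat_vec s + r *\<^sub>R q"
        using False by (auto simp: convex_hull_insert_alt)
      have "0 \<le> rat_vec a \<bullet> (x - rat_vec s) + r * (rat_vec a \<bullet> rat_vec s + of_rat b)" if "(a, b) \<in> I" for a b
      proof -
        have "0 \<le> r * (rat_vec a \<bullet> q + of_rat b)" using q that r I by auto
        then show ?thesis by (simp add: x algebra_simps inner_add_right inner_diff_right)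
      qed
      then show ?R using r unfolding E by auto
    next
      assume ?R
      then obtain r where r: "0 \<le> r" "r \<le> 1" and
        I': "\<And>a b. (a, b) \<in> I \<Longrightarrow> 0 \<le> rat_vec a \<bullet> (x - rat_vec s) + r * (rat_vec a \<bullet> rat_vec s + of_rat b)"
        unfolding E by auto
      show ?L
      proof (cases "r = 0")
        case True
        then have "x - rat_vec s = 0" using I' by (intro recession) auto
        then show ?thesis by (simp add: hull_inc)
      next
        case False
        define q where "q = rat_vec s + (1 / r) *\<^sub>R (x - rat_vec s)"
        have "0 \<le> rat_vec a \<bullet> q + of_rat b" if "(a, b) \<in> I" for a b
        proof -
          have "0 \<le> (1 / r) * (rat_vec a \<bullet> (x - rat_vec s) + r * (rat_vec a \<bullet> rat_vec s + of_rat b))"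
            using I'[OF that] r by (intro mult_nonneg_nonneg) auto
          also have "\<dots> = rat_vec a \<bullet> q + of_rat b"
            using False by (simp add: q_def inner_add_right distrib_left)
          finally show ?thesis .
        qed
        then have "q \<in> convex hull (rat_vec ` S)" unfolding I by auto
        moreover have "x = (1 - r) *\<^sub>R rat_vec s + r *\<^sub>R q"
          using False by (simp add: q_def algebra_simps)
        ultimately show ?thesis using r \<open>S \<noteq> {}\<close> by (auto simp: convex_hull_insert_alt)
      qed
    qed
    have "finite E" using finI by (simp add: E_def)
    then obtain I' :: "((rat ^ 'd) \<times> rat) set" where "finite I'"
      "\<And>x. (\<exists>r. \<forall>(a, b, \<beta>)\<in>E. 0 \<le> rat_vec a \<bullet> x + of_rat b + r * of_rat \<beta>)
        \<longleftrightarrow> (\<forall>(a, b)\<in>I'. 0 \<le> rat_vec a \<bullet> x + of_rat b)"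
      using rational_Fourier_Motzkin[of E] by metis
    then show ?thesis using hull by (intro exI[of _ I']) auto
  qed
qed

text \<open>By Krein-Milman the polytope is the hull of its finitely many extreme points, which are
  rational.\<close>

lemma rational_polytope_halfspaces:
  fixes P :: "(real ^ 'd::finite) set"
  assumes "rational_polytope P"
  obtains I :: "((rat ^ 'd) \<times> real) set" where "finite I"
    "P = {x. \<forall>j\<in>I. 0 \<le> rat_vec (fst j) \<bullet> x + snd j}"
proof -
  have P: "polytope P" and rat: "\<And>v i. v extreme_point_of P \<Longrightarrow> v $ i \<in> \<rat>"
    using assms by (auto simp: rational_polytope_def)
  have fin: "finite {v. v extreme_point_of P}"
    using P by (simp add: finite_polyhedron_extreme_points polytope_imp_polyhedron)
  have "\<exists>s. v = rat_vec s" if v: "v extreme_point_of P" for v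
  proof -
    obtain s where "\<And>i. v $ i = of_rat (s i)" using rat[OF v] unfolding Rats_def image_iff by metis
    then show ?thesis by (intro exI[of _ "\<chi> i. s i"]) (simp add: rat_vec_def vec_eq_iff)
  qed
  then have "{v. v extreme_point_of P} \<subseteq> range rat_vec" by blast
  then obtain S where S: "finite S" "{v. v extreme_point_of P} = rat_vec ` S"
    using finite_subset_image[OF fin, of rat_vec UNIV] by metis
  obtain I :: "((rat ^ 'd) \<times> rat) set" where I: "finite I"
    "convex hull (rat_vec ` S) = {x. \<forall>(a, b)\<in>I. 0 \<le> rat_vec a \<bullet> x + of_rat b}"
    using rational_convex_hull_halfspaces[OF S(1)] by blast
  have "P = convex hull (rat_vec ` S)"
    using Krein_Milman_Minkowski[of P] P S(2) by (simp add: polytope_imp_compact polytope_imp_convex)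
  then show ?thesis
    using I by (intro that[of "apsnd of_rat ` I"]) (auto simp: case_prod_unfold)
qed

section \<open>Halfspaces and their germs\<close>

text \<open>A pair \<open>(a, b)\<close> stands for the closed halfspace \<open>a \<bullet> x + b \<ge> 0\<close>. Only the normal has to be
  rational: the apex of a cone may be any real point.\<close>

definition slack :: "(rat ^ 'd::finite) \<times> real \<Rightarrow> real ^ 'd \<Rightarrow> real" where
  "slack j x = rat_vec (fst j) \<bullet> x + snd j"

definition hs :: "(rat ^ 'd::finite) \<times> real \<Rightarrow> real ^ 'd \<Rightarrow> int" where
  "hs j x = (if 0 \<le> slack j x then 1 else 0)"

text \<open>The limit of \<open>hs j (v + \<epsilon> *\<^sub>R (x - v))\<close> as \<open>\<epsilon>\<close> decreases to \<open>0\<close>.\<close>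

definition germ :: "real ^ 'd \<Rightarrow> (rat ^ 'd::finite) \<times> real \<Rightarrow> real ^ 'd \<Rightarrow> int" where
  "germ v j x =
     (if slack j v = 0 then if 0 \<le> rat_vec (fst j) \<bullet> (x - v) then 1 else 0
      else if 0 < slack j v then 1 else 0)"

lemma slack_affine: "slack j (v + e *\<^sub>R (x - v)) = slack j v + e * (rat_vec (fst j) \<bullet> (x - v))"
  by (simp add: slack_def inner_add_right)

text \<open>Finitely many limits are attained simultaneously for small \<open>e\<close>. Hence all
  germs at \<open>x\<close> are halfspace indicators at one common point, and every pointwise
  identity between the indicators passes to the germs.\<close>

lemma germ_eq_hs_near:
  assumes "finite I"
  obtains e where "e > 0" "\<And>j. j \<in> I \<Longrightarrow> germ v j x = hs j (v + e *\<^sub>R (x - v))"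
proof -
  have "\<forall>\<^sub>F e in at_right (0::real). germ v j x = hs j (v + e *\<^sub>R (x - v))" for j
  proof -
    have lim: "((\<lambda>e. slack j (v + e *\<^sub>R (x - v))) \<longlongrightarrow> slack j v) (at_right 0)"
      unfolding slack_affine by (auto intro!: tendsto_eq_intros)
    consider "slack j v = 0" | "0 < slack j v" | "slack j v < 0" by linarith
    then show ?thesis
    proof cases
      case 1
      show ?thesis
        using eventually_at_right_less[of "0::real"]
        by eventually_elim (use 1 in \<open>simp add: germ_def hs_def slack_affine zero_le_mult_iff\<close>)
    next
      case 2
      show ?thesis
        using order_tendstoD(1)[OF lim 2] by eventually_elim (use 2 in \<open>simp add: germ_def hs_def\<close>)
    next
      case 3
      show ?thesis
        using order_tendstoD(2)[OF lim 3] by eventually_elim (use 3 in \<open>simp add: germ_def hs_def\<close>)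
    qed
  qed
  then have "\<forall>\<^sub>F e in at_right (0::real). \<forall>j\<in>I. germ v j x = hs j (v + e *\<^sub>R (x - v))"
    using assms by (simp add: eventually_ball_finite)
  then have "\<forall>\<^sub>F e in at_right (0::real). 0 < e \<and> (\<forall>j\<in>I. germ v j x = hs j (v + e *\<^sub>R (x - v)))"
    using eventually_at_right_less[of "0::real"] by eventually_elim simp
  then have "\<exists>e. 0 < e \<and> (\<forall>j\<in>I. germ v j x = hs j (v + e *\<^sub>R (x - v)))"
    by (rule eventually_happens'[rotated]) simp
  then show ?thesis using that by blast
qed

section \<open>Infeasible sign patterns and reduction to independent normals\<close>

definition indep_normals :: "((rat ^ 'd::finite) \<times> real) set \<Rightarrow> bool" where
  "indep_normals J \<longleftrightarrow> inj_on fst J \<and> vec.independent (fst ` J)"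

definition infeasible_pattern ::
    "((rat ^ 'd::finite) \<times> real) set \<Rightarrow> ((rat ^ 'd) \<times> real) set \<Rightarrow> bool" where
  "infeasible_pattern J B \<longleftrightarrow>
     (\<forall>x. (\<exists>j\<in>J - B. slack j x < 0) \<or> (\<exists>j\<in>B. 0 \<le> slack j x))"

text \<open>At a point realizing the pattern every \<open>c j * slack j x\<close> is nonnegative,
  and positive where \<open>c j < 0\<close>. But the normals cancel in the sum, leaving the
  constant, which contradicts \<open>const\<close>.\<close>

lemma infeasible_pattern_of_relation:
  fixes c :: "(rat ^ 'd::finite) \<times> real \<Rightarrow> rat"
  assumes fin: "finite J" and rel: "(\<Sum>j\<in>J. c j *s fst j) = 0"
    and const: "(\<Sum>j\<in>J. of_rat (c j) * snd j) < 0 \<or>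
      (\<Sum>j\<in>J. of_rat (c j) * snd j) = 0 \<and> (\<exists>j\<in>J. c j < 0)"
  shows "infeasible_pattern J {j\<in>J. c j < 0}"
  unfolding infeasible_pattern_def
proof (rule allI, rule ccontr)
  fix x :: "real ^ 'd"
  assume "\<not> ((\<exists>j\<in>J - {j \<in> J. c j < 0}. slack j x < 0) \<or> (\<exists>j\<in>{j \<in> J. c j < 0}. 0 \<le> slack j x))"
  then have pos: "\<And>j. j \<in> J \<Longrightarrow> 0 \<le> c j \<Longrightarrow> 0 \<le> slack j x"
    and neg: "\<And>j. j \<in> J \<Longrightarrow> c j < 0 \<Longrightarrow> slack j x < 0"
    by (metis (mono_tags, lifting) DiffI mem_Collect_eq not_less)+
  have term_nonneg: "0 \<le> of_rat (c j) * slack j x" if "j \<in> J" for j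
    using pos[OF that] neg[OF that] by (cases "c j < 0") (auto simp: zero_le_mult_iff)
  have "(\<Sum>j\<in>J. of_rat (c j) * slack j x) = rat_vec (\<Sum>j\<in>J. c j *s fst j) \<bullet> x + (\<Sum>j\<in>J. of_rat (c j) * snd j)"
    by (simp add: slack_def rat_vec_sum rat_vec_scale inner_sum_left distrib_left sum.distrib)
  then have eq: "(\<Sum>j\<in>J. of_rat (c j) * slack j x) = (\<Sum>j\<in>J. of_rat (c j) * snd j)"
    by (simp add: rel)
  have "0 \<le> (\<Sum>j\<in>J. of_rat (c j) * slack j x)" by (rule sum_nonneg) (rule term_nonneg)
  then obtain j where j: "j \<in> J" "c j < 0" and zero: "(\<Sum>j\<in>J. of_rat (c j) * slack j x) = 0"
    using const eq by auto
  have "0 < of_rat (c j) * slack j x" using j neg by (simp add: mult_neg_neg)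
  then have "0 < (\<Sum>j\<in>J. of_rat (c j) * slack j x)"
    using fin j(1) term_nonneg by (intro sum_pos2[of J j]) auto
  then show False using zero by simp
qed

text \<open>Both a relation and its negative may be used. A nonzero constant term decides the sign;
  if it is zero, some nonzero coefficient is negative in one of the two.\<close>

lemma exists_infeasible_pattern:
  fixes J :: "((rat ^ 'd::finite) \<times> real) set"
  assumes fin: "finite J" and dep: "\<not> indep_normals J"
  obtains B where "B \<subseteq> J" "infeasible_pattern J B"
proof -
  have "\<exists>c. (\<exists>j\<in>J. c j \<noteq> 0) \<and> (\<Sum>j\<in>J. c j *s fst j) = 0"
  proof (cases "inj_on fst J")
    case True
    then have "vec.dependent (fst ` J)" using dep by (simp add: indep_normals_def)
    then obtain u where u: "\<exists>a\<in>fst ` J. u a \<noteq> 0" "(\<Sum>a\<in>fst ` J. u a *s a) = 0"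
      using vec.dependent_finite[of "fst ` J"] fin by auto
    then show ?thesis
      using True by (intro exI[of _ "\<lambda>j. u (fst j)"]) (auto simp: sum.reindex)
  next
    case False
    then obtain j k where jk: "j \<in> J" "k \<in> J" "j \<noteq> k" "fst j = fst k" by (auto simp: inj_on_def)
    \<comment> \<open>Two halfspaces with equal normals also count as dependent; the relation
      subtracts one normal from the other.\<close>
    let ?c = "\<lambda>i. (if i = j then 1 else if i = k then - 1 else 0) :: rat"
    have "(\<Sum>i\<in>J. ?c i *s fst i) = (\<Sum>i\<in>{j, k}. ?c i *s fst i)"
      using fin jk by (intro sum.mono_neutral_right) auto
    also have "\<dots> = 0" using jk by simp
    finally show ?thesis using jk by (intro exI[of _ ?c]) auto
  qed
  then obtain c where c: "\<exists>j\<in>J. c j \<noteq> 0" "(\<Sum>j\<in>J. c j *s fst j) = 0" by blast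
  have c': "(\<Sum>j\<in>J. - c j *s fst j) = 0"
    by (simp only: vec.scale_minus_left sum_negf c(2) minus_zero)
  have neg: "(\<Sum>j\<in>J. of_rat (- c j) * snd j) = - (\<Sum>j\<in>J. of_rat (c j) * snd j)"
    by (simp add: of_rat_minus sum_negf)
  let ?K = "\<Sum>j\<in>J. of_rat (c j) * snd j"
  consider "?K < 0 \<or> ?K = 0 \<and> (\<exists>j\<in>J. c j < 0)" | "?K > 0 \<or> ?K = 0 \<and> (\<exists>j\<in>J. - c j < 0)"
    using c(1) by (metis linorder_neqE_linordered_idom neg_less_0_iff_less)
  then show ?thesis
  proof cases
    case 1
    then show ?thesis using infeasible_pattern_of_relation[OF fin c(2)] by (intro that) auto
  next
    case 2
    then have "(\<Sum>j\<in>J. of_rat (- c j) * snd j) < 0 \<or>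
      (\<Sum>j\<in>J. of_rat (- c j) * snd j) = 0 \<and> (\<exists>j\<in>J. - c j < 0)" unfolding neg by auto
    then show ?thesis using infeasible_pattern_of_relation[OF fin c'] by (intro that) auto
  qed
qed

text \<open>The sum expands the product of \<open>e j\<close> over \<open>J - B\<close> times the
  product of \<open>1 - e j\<close> over \<open>B\<close>, where infeasibility makes a factor
  vanish. Keeping \<open>e\<close> abstract covers both the indicators and their germs.\<close>

lemma infeasible_pattern_expansion:
  assumes fin: "finite J" and B: "B \<subseteq> J" and inf: "infeasible_pattern J B"
    and e: "\<And>j. j \<in> J \<Longrightarrow> e j = hs j y"
  shows "(\<Sum>C\<in>Pow B. (- 1) ^ card C * (\<Prod>j\<in>(J - B) \<union> C. e j)) = (0::int)"
proof -
  have finB: "finite B" using B fin by (rule finite_subset)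
  have "(\<Prod>j\<in>(J - B) \<union> C. e j) = (\<Prod>j\<in>J - B. e j) * (\<Prod>j\<in>C. e j)" if "C \<in> Pow B" for C
    using that fin finite_subset[OF _ finB] by (intro prod.union_disjoint) auto
  then have "(\<Sum>C\<in>Pow B. (- 1) ^ card C * (\<Prod>j\<in>(J - B) \<union> C. e j))
      = (\<Prod>j\<in>J - B. e j) * (\<Sum>C\<in>Pow B. (- 1) ^ card C * (\<Prod>j\<in>C. e j) * (\<Prod>j\<in>B - C. 1))"
    unfolding sum_distrib_left by (intro sum.cong) (auto simp: mult_ac)
  also have "\<dots> = (\<Prod>j\<in>J - B. e j) * (\<Prod>j\<in>B. 1 - e j)"
    by (simp only: prod_diff_conv_sum[OF finB])
  also have "\<dots> = 0"
  proof -
    consider j where "j \<in> J - B" "slack j y < 0" | j where "j \<in> B" "0 \<le> slack j y"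
      using inf unfolding infeasible_pattern_def by blast
    then show ?thesis
    proof cases
      case 1
      then have "e j = 0" using e[of j] by (auto simp: hs_def)
      then have "(\<Prod>j\<in>J - B. e j) = 0"
        using fin 1(1) by (intro prod_zero bexI[of _ j]) auto
      then show ?thesis by simp
    next
      case 2
      then have "e j = 1" using e[of j] B by (auto simp: hs_def)
      then have "(\<Prod>j\<in>B. 1 - e j) = 0"
        using finB 2(1) by (intro prod_zero bexI[of _ j]) auto
      then show ?thesis by simp
    qed
  qed
  finally show ?thesis .
qed

text \<open>If the normals are dependent, solve the relation for its summand \<open>C = B\<close>,
  which is \<open>g J\<close> up to sign. The other summands involve proper subsets of
  \<open>J\<close> and fall under the induction hypothesis.\<close>

lemma reduce_to_independent_normals:
  fixes g :: "((rat ^ 'd::finite) \<times> real) set \<Rightarrow> 's \<Rightarrow> int"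
  assumes "finite J"
    and zero: "N (\<lambda>_. 0)"
    and add: "\<And>f h. N f \<Longrightarrow> N h \<Longrightarrow> N (\<lambda>x. f x + h x)"
    and neg: "\<And>f. N f \<Longrightarrow> N (\<lambda>x. - f x)"
    and rel: "\<And>J' B x. J' \<subseteq> J \<Longrightarrow> B \<subseteq> J' \<Longrightarrow> infeasible_pattern J' B \<Longrightarrow>
      (\<Sum>C\<in>Pow B. (- 1) ^ card C * g ((J' - B) \<union> C) x) = 0"
    and base: "\<And>J'. J' \<subseteq> J \<Longrightarrow> indep_normals J' \<Longrightarrow> N (g J')"
  shows "N (g J)"
  using assms(1) rel base
proof (induction J rule: finite_psubset_induct)
  case (psubset J)
  show ?case
  proof (cases "indep_normals J")
    case True
    then show ?thesis using psubset.prems(2) by blast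
  next
    case False
    then obtain B where B: "B \<subseteq> J" "infeasible_pattern J B"
      using exists_infeasible_pattern psubset.hyps by blast
    have finB: "finite B" using B(1) psubset.hyps by (rule finite_subset)
    have sgn: "N (\<lambda>x. (- 1) ^ n * f x)" if "N f" for n :: nat and f
      using that neg[OF that] by (cases "even n") auto
    have sum: "N (\<lambda>x. \<Sum>C\<in>\<C>. f C x)" if "\<And>C. C \<in> \<C> \<Longrightarrow> N (f C)" for \<C> :: "((rat ^ 'd) \<times> real) set set" and f
      using that by (induction \<C> rule: infinite_finite_induct) (auto intro: zero add)
    define r where "r = (\<lambda>x. \<Sum>C\<in>Pow B - {B}. (- 1) ^ card C * g ((J - B) \<union> C) x)"
    have "N r" unfolding r_def
    proof (intro sum sgn)
      fix C assume C: "C \<in> Pow B - {B}"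
      then have sub: "(J - B) \<union> C \<subset> J" using B(1) by blast
      show "N (g ((J - B) \<union> C))"
      proof (rule psubset.IH[OF sub])
        fix J' B' x assume "J' \<subseteq> (J - B) \<union> C" and J': "B' \<subseteq> J'" "infeasible_pattern J' B'"
        then have "J' \<subseteq> J" using sub by blast
        then show "(\<Sum>C\<in>Pow B'. (- 1) ^ card C * g ((J' - B') \<union> C) x) = 0"
          using J' by (rule psubset.prems(1))
      next
        fix J' assume "J' \<subseteq> (J - B) \<union> C" and J': "indep_normals J'"
        then have "J' \<subseteq> J" using sub by blast
        then show "N (g J')" using J' by (rule psubset.prems(2))
      qed
    qed
    have "(- 1) ^ card B * g J x + r x = 0" for x
    proof -
      have "(\<Sum>C\<in>Pow B. (- 1) ^ card C * g ((J - B) \<union> C) x) = (- 1) ^ card B * g ((J - B) \<union> B) x + r x"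
        unfolding r_def using finB by (subst sum.remove[of _ B]) auto
      moreover have "(J - B) \<union> B = J" using B(1) by blast
      ultimately show ?thesis using psubset.prems(1)[OF order_refl B, of x] by simp
    qed
    then have "g J x = - ((- 1) ^ card B * r x)" for x
      by (cases "even (card B)") (auto simp: add_eq_0_iff add_eq_0_iff2)
    then have "g J = (\<lambda>x. - ((- 1) ^ card B * r x))" by (rule ext)
    then show ?thesis using neg[OF sgn[OF \<open>N r\<close>]] by simp
  qed
qed

text \<open>Each dual vector adjusts one slack without changing the others.\<close>

lemma exists_apex:
  fixes J :: "((rat ^ 'd::finite) \<times> real) set"
  assumes fin: "finite J" and J: "indep_normals J"
  shows "\<exists>v. \<forall>j\<in>J. slack j v = 0"
proof -
  obtain u where u: "\<And>a. a \<in> fst ` J \<Longrightarrow> rat_vec a \<bullet> real_vec (u a) > 0"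
    "\<And>a b. a \<in> fst ` J \<Longrightarrow> b \<in> fst ` J \<Longrightarrow> a \<noteq> b \<Longrightarrow> rat_vec a \<bullet> real_vec (u b) = 0"
    using rational_dual_vectors[of "fst ` J"] J by (auto simp: indep_normals_def)
  define y where "y i = real_vec (u (fst i))" for i :: "(rat ^ 'd) \<times> real"
  define v where "v = - (\<Sum>i\<in>J. (snd i / (rat_vec (fst i) \<bullet> y i)) *\<^sub>R y i)"
  have "slack j v = 0" if j: "j \<in> J" for j
  proof -
    have "rat_vec (fst j) \<bullet> v = - (\<Sum>i\<in>J. (snd i / (rat_vec (fst i) \<bullet> y i)) * (rat_vec (fst j) \<bullet> y i))"
      by (simp add: v_def inner_sum_right)
    also have "(\<Sum>i\<in>J. (snd i / (rat_vec (fst i) \<bullet> y i)) * (rat_vec (fst j) \<bullet> y i))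
        = (\<Sum>i\<in>{j}. (snd i / (rat_vec (fst i) \<bullet> y i)) * (rat_vec (fst j) \<bullet> y i))"
    proof (rule sum.mono_neutral_right[OF fin])
      show "\<forall>i\<in>J - {j}. snd i / (rat_vec (fst i) \<bullet> y i) * (rat_vec (fst j) \<bullet> y i) = 0"
        using u(2) j J unfolding y_def indep_normals_def inj_on_def by auto
    qed (use j in auto)
    also have "\<dots> = snd j" using u(1)[of "fst j"] j by (simp add: y_def)
    finally show ?thesis by (simp add: slack_def)
  qed
  then show ?thesis by blast
qed

section \<open>Brion's identity modulo periodic functions\<close>

text \<open>Admitting any integer valued \<open>g\<close> makes the series additive in
  \<open>g\<close>, so signed sums of indicators can be treated like sets.\<close>

definition weighted_series :: "(int ^ 'd::finite \<Rightarrow> 'g::ab_group_add) \<Rightarrow> (int ^ 'd \<Rightarrow> 'r::comm_ring_1) \<Rightarrow>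
    (real ^ 'd \<Rightarrow> int) \<Rightarrow> ('d, ('g, 'r) group_ring) formal_series" where
  "weighted_series \<phi> c g = (\<lambda>\<alpha>. Poly_Mapping.single (\<phi> \<alpha>) (of_int (g (real_vec \<alpha>)) * c \<alpha>))"

lemma weighted_series_zero: "weighted_series \<phi> c (\<lambda>_. 0) = (\<lambda>_. 0)"
  by (simp add: weighted_series_def)

lemma weighted_series_add:
  "weighted_series \<phi> c (\<lambda>x. f x + g x) = (\<lambda>\<alpha>. weighted_series \<phi> c f \<alpha> + weighted_series \<phi> c g \<alpha>)"
  by (simp add: weighted_series_def distrib_right single_add)

lemma weighted_series_uminus:
  "weighted_series \<phi> c (\<lambda>x. - f x) = (\<lambda>\<alpha>. - weighted_series \<phi> c f \<alpha>)"
  by (simp add: weighted_series_def single_uminus)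

lemma weighted_series_sum:
  "weighted_series \<phi> c (\<lambda>x. \<Sum>i\<in>A. f i x) = (\<lambda>\<alpha>. \<Sum>i\<in>A. weighted_series \<phi> c (f i) \<alpha>)"
  by (induction A rule: infinite_finite_induct) (auto simp: weighted_series_zero weighted_series_add)

lemma point_series_eq_weighted_series:
  assumes "\<And>x. g x = (if x \<in> Q then 1 else 0)"
  shows "point_series Q \<phi> w = weighted_series \<phi> (poly_eval w) g"
  by (auto simp: point_series_def weighted_series_def assms)

text \<open>Polynomiality of the weight enters only as nilpotency of its differences in every
  direction.\<close>

locale polynomial_weight =
  fixes \<phi> :: "int ^ 'd::finite \<Rightarrow> 'g::ab_group_add" and c :: "int ^ 'd \<Rightarrow> 'r::comm_ring_1"
  assumes hom: "\<And>\<alpha> \<beta>. \<phi> (\<alpha> + \<beta>) = \<phi> \<alpha> + \<phi> \<beta>"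
    and nilpotent: "\<And>u. diff_nilpotent u c"
begin

definition null :: "(real ^ 'd \<Rightarrow> int) \<Rightarrow> bool" where
  "null g \<longleftrightarrow> series_represents (weighted_series \<phi> c g) 0"

definition representable :: "(real ^ 'd \<Rightarrow> int) \<Rightarrow> bool" where
  "representable g \<longleftrightarrow> (\<exists>F. series_represents (weighted_series \<phi> c g) F)"

lemma null_zero: "null (\<lambda>_. 0)"
  by (simp add: null_def weighted_series_zero series_represents_zero_zero)

lemma null_add: "null f \<Longrightarrow> null g \<Longrightarrow> null (\<lambda>x. f x + g x)"
  unfolding null_def weighted_series_add by (drule (1) series_represents_add) simp

lemma null_uminus: "null f \<Longrightarrow> null (\<lambda>x. - f x)"
  unfolding null_def weighted_series_uminus by (drule series_represents_uminus) simp

lemma null_sum: "(\<And>i. i \<in> A \<Longrightarrow> null (f i)) \<Longrightarrow> null (\<lambda>x. \<Sum>i\<in>A. f i x)"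
  by (induction A rule: infinite_finite_induct) (auto intro: null_zero null_add)

lemma null_imp_representable: "null g \<Longrightarrow> representable g"
  by (auto simp: null_def representable_def)

lemma representable_add: "representable f \<Longrightarrow> representable g \<Longrightarrow> representable (\<lambda>x. f x + g x)"
  unfolding representable_def weighted_series_add by (blast intro: series_represents_add)

lemma representable_uminus: "representable f \<Longrightarrow> representable (\<lambda>x. - f x)"
  unfolding representable_def weighted_series_uminus by (blast intro: series_represents_uminus)

text \<open>A periodic function has zero first difference, and nilpotency survives multiplication by
  the weight.\<close>

lemma null_of_periodic:
  assumes "u \<noteq> 0" "\<And>x. g (x - real_vec u) = g x"
  shows "null g"
proof -
  have "diff_nilpotent u (\<lambda>\<alpha>. of_int (g (real_vec \<alpha>)) :: 'r)"
    unfolding diff_nilpotent_def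
    by (rule exI[of _ 1]) (simp add: diff_op_def real_vec_diff assms(2))
  then show ?thesis
    unfolding null_def weighted_series_def
    by (intro series_represents_zero_of_diff_nilpotent[OF hom assms(1)] diff_nilpotent_mult nilpotent)
qed

lemma hs_prod_null:
  assumes "vec.span (fst ` J) \<noteq> UNIV"
  shows "null (\<lambda>x. \<Prod>j\<in>J. hs j x)"
proof -
  obtain u where u: "u \<noteq> 0" "\<And>a. a \<in> fst ` J \<Longrightarrow> rat_vec a \<bullet> real_vec u = 0"
    using integer_orthogonal_vector[OF assms] by blast
  show ?thesis
    by (rule null_of_periodic[OF u(1)], rule prod.cong)
       (use u(2) in \<open>auto simp: hs_def slack_def inner_diff_right\<close>)
qed

text \<open>The germ of a halfspace whose boundary misses \<open>v\<close> is constant, so only the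
  tight normals restrict the periods.\<close>

lemma germ_prod_null:
  assumes "vec.span (fst ` {j \<in> J. slack j v = 0}) \<noteq> UNIV"
  shows "null (\<lambda>x. \<Prod>j\<in>J. germ v j x)"
proof -
  obtain u where u: "u \<noteq> 0" "\<And>a. a \<in> fst ` {j \<in> J. slack j v = 0} \<Longrightarrow> rat_vec a \<bullet> real_vec u = 0"
    using integer_orthogonal_vector[OF assms] by blast
  show ?thesis
    by (rule null_of_periodic[OF u(1)], rule prod.cong)
       (use u(2) in \<open>auto simp: germ_def inner_diff_right\<close>)
qed

text \<open>Otherwise the normal of \<open>j\<close> would lie in the span of the other
  normals.\<close>

lemma all_tight_of_spanning:
  assumes "indep_normals J" "vec.span (fst ` {j \<in> J. slack j v = 0}) = UNIV" "j \<in> J"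
  shows "slack j v = 0"
proof (rule ccontr)
  assume "slack j v \<noteq> 0"
  then have "fst ` {j \<in> J. slack j v = 0} \<subseteq> fst ` J - {fst j}"
    using assms(1,3) by (auto simp: indep_normals_def inj_on_def)
  then have "fst j \<in> vec.span (fst ` J - {fst j})"
    using vec.span_mono assms(2) by blast
  then show False
    using assms(1,3) by (auto simp: indep_normals_def vec.dependent_def)
qed

text \<open>Either the tight normals leave a period, or all halfspaces are tight and the product is
  the indicator of a simplicial cone with apex \<open>v\<close>.\<close>

lemma germ_prod_representable_indep:
  assumes J: "indep_normals J"
  shows "representable (\<lambda>x. \<Prod>j\<in>J. germ v j x)"
proof (cases "vec.span (fst ` {j \<in> J. slack j v = 0}) = UNIV")
  case False
  then show ?thesis by (intro null_imp_representable germ_prod_null)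
next
  case True
  have tight: "slack j v = 0" if "j \<in> J" for j
    using all_tight_of_spanning[OF J True that] .
  then have "vec.span (fst ` J) = UNIV" using True by (simp cong: conj_cong)
  then have "\<exists>F. series_represents (\<lambda>\<alpha>. Poly_Mapping.single (\<phi> \<alpha>)
      (of_int (\<Prod>a\<in>fst ` J. if rat_vec a \<bullet> (real_vec \<alpha> - v) \<ge> 0 then 1 else 0) * c \<alpha>)) F"
    using J by (intro simplicial_cone_representable hom nilpotent) (simp_all add: indep_normals_def)
  moreover have "(\<Prod>a\<in>fst ` J. if rat_vec a \<bullet> (x - v) \<ge> 0 then 1 else 0) = (\<Prod>j\<in>J. germ v j x)" for x
    using J tight by (subst prod.reindex) (auto simp: indep_normals_def germ_def intro!: prod.cong)
  ultimately show ?thesis by (simp add: representable_def weighted_series_def)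
qed

lemma germ_prod_representable:
  assumes fin: "finite J"
  shows "representable (\<lambda>x. \<Prod>j\<in>J. germ v j x)"
proof (rule reduce_to_independent_normals[where N = representable and g = "\<lambda>J x. \<Prod>j\<in>J. germ v j x", OF fin])
  fix J' B x assume J': "J' \<subseteq> J" "B \<subseteq> J'" "infeasible_pattern J' B"
  have finJ': "finite J'" using J'(1) fin by (rule finite_subset)
  obtain e where "\<And>j. j \<in> J' \<Longrightarrow> germ v j x = hs j (v + e *\<^sub>R (x - v))"
    using germ_eq_hs_near[OF finJ'] by blast
  then show "(\<Sum>C\<in>Pow B. (- 1) ^ card C * (\<Prod>j\<in>(J' - B) \<union> C. germ v j x)) = 0"
    by (rule infeasible_pattern_expansion[OF finJ' J'(2,3)])
qed (auto intro: null_imp_representable null_zero representable_add representable_uminus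
    germ_prod_representable_indep)

text \<open>If the normals span, every point other than the apex contributes a function that is periodic
  along a line.\<close>

lemma Brion_independent_null:
  assumes fin: "finite J" "finite V" and J: "indep_normals J"
    and apex: "\<exists>v\<in>V. \<forall>j\<in>J. slack j v = 0"
  shows "null (\<lambda>x. (\<Prod>j\<in>J. hs j x) - (\<Sum>v\<in>V. \<Prod>j\<in>J. germ v j x))"
proof (cases "vec.span (fst ` J) = UNIV")
  case False
  have "vec.span (fst ` {j \<in> J. slack j v = 0}) \<noteq> UNIV" for v
    using False vec.span_mono[of "fst ` {j \<in> J. slack j v = 0}" "fst ` J"] by auto
  then have "null (\<lambda>x. (\<Prod>j\<in>J. hs j x) + - (\<Sum>v\<in>V. \<Prod>j\<in>J. germ v j x))"
    using False by (intro null_add null_uminus null_sum hs_prod_null germ_prod_null)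
  then show ?thesis by simp
next
  case True
  obtain p where p: "p \<in> V" "\<And>j. j \<in> J \<Longrightarrow> slack j p = 0" using apex by blast
  \<comment> \<open>At the apex every halfspace equals its own germ, so this summand cancels the
    product of indicators.\<close>
  have "germ p j x = hs j x" if "j \<in> J" for j x
    using p(2)[OF that] by (simp add: germ_def hs_def slack_def inner_diff_right algebra_simps)
  then have "(\<Prod>j\<in>J. germ p j x) = (\<Prod>j\<in>J. hs j x)" for x by (intro prod.cong) auto
  then have "(\<Prod>j\<in>J. hs j x) - (\<Sum>v\<in>V. \<Prod>j\<in>J. germ v j x) = - (\<Sum>v\<in>V - {p}. \<Prod>j\<in>J. germ v j x)" for x
    using fin(2) p(1) by (subst sum.remove[of _ p]) auto
  moreover have "null (\<lambda>x. - (\<Sum>v\<in>V - {p}. \<Prod>j\<in>J. germ v j x))"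
  proof (intro null_uminus null_sum germ_prod_null notI)
    fix v assume v: "v \<in> V - {p}" "vec.span (fst ` {j \<in> J. slack j v = 0}) = UNIV"
    \<comment> \<open>All slacks vanish at both \<open>v\<close> and \<open>p\<close>, so
      \<open>v - p\<close> is orthogonal to spanning normals.\<close>
    have "rat_vec a \<bullet> (v - p) = 0" if a: "a \<in> fst ` J" for a
    proof -
      obtain j where "j \<in> J" "a = fst j" using a by blast
      then show ?thesis
        using p(2)[of j] all_tight_of_spanning[OF J v(2), of j] by (simp add: slack_def inner_diff_right)
    qed
    then have "v - p = 0" by (rule spanning_orthogonal_zero[OF True])
    then show False using v(1) by simp
  qed
  ultimately show ?thesis by simp
qed

text \<open>The same \<open>V\<close> serves all subsets of \<open>I\<close> in the reduction, which
  is why it has to contain an apex for each independent one.\<close>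

lemma Brion_null:
  assumes fin: "finite I" "finite V"
    and V: "\<And>J. J \<subseteq> I \<Longrightarrow> indep_normals J \<Longrightarrow> \<exists>v\<in>V. \<forall>j\<in>J. slack j v = 0"
  shows "null (\<lambda>x. (\<Prod>j\<in>I. hs j x) - (\<Sum>v\<in>V. \<Prod>j\<in>I. germ v j x))"
proof (rule reduce_to_independent_normals[where N = null and
      g = "\<lambda>J x. (\<Prod>j\<in>J. hs j x) - (\<Sum>v\<in>V. \<Prod>j\<in>J. germ v j x)", OF fin(1)])
  fix J B x assume J: "J \<subseteq> I" "B \<subseteq> J" "infeasible_pattern J B"
  have finJ: "finite J" using J(1) fin(1) by (rule finite_subset)
  have germ: "(\<Sum>C\<in>Pow B. (- 1) ^ card C * (\<Prod>j\<in>(J - B) \<union> C. germ v j x)) = 0" for v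
  proof -
    obtain e where "\<And>j. j \<in> J \<Longrightarrow> germ v j x = hs j (v + e *\<^sub>R (x - v))"
      using germ_eq_hs_near[OF finJ] by blast
    then show ?thesis by (rule infeasible_pattern_expansion[OF finJ J(2,3)])
  qed
  have "(\<Sum>C\<in>Pow B. (- 1) ^ card C * ((\<Prod>j\<in>(J - B) \<union> C. hs j x) - (\<Sum>v\<in>V. \<Prod>j\<in>(J - B) \<union> C. germ v j x)))
      = (\<Sum>C\<in>Pow B. (- 1) ^ card C * (\<Prod>j\<in>(J - B) \<union> C. hs j x))
        - (\<Sum>C\<in>Pow B. \<Sum>v\<in>V. (- 1) ^ card C * (\<Prod>j\<in>(J - B) \<union> C. germ v j x))"
    by (simp add: right_diff_distrib sum_subtractf sum_distrib_left)
  also have "(\<Sum>C\<in>Pow B. \<Sum>v\<in>V. (- 1) ^ card C * (\<Prod>j\<in>(J - B) \<union> C. germ v j x)) = 0"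
    by (subst sum.swap) (simp add: germ)
  also have "(\<Sum>C\<in>Pow B. (- 1) ^ card C * (\<Prod>j\<in>(J - B) \<union> C. hs j x)) = 0"
    by (rule infeasible_pattern_expansion[OF finJ J(2,3)]) simp
  finally show "(\<Sum>C\<in>Pow B. (- 1) ^ card C * ((\<Prod>j\<in>(J - B) \<union> C. hs j x)
      - (\<Sum>v\<in>V. \<Prod>j\<in>(J - B) \<union> C. germ v j x))) = 0" by simp
next
  fix J assume "J \<subseteq> I" "indep_normals J"
  then show "null (\<lambda>x. (\<Prod>j\<in>J. hs j x) - (\<Sum>v\<in>V. \<Prod>j\<in>J. germ v j x))"
    using fin V finite_subset by (intro Brion_independent_null) auto
qed (auto intro: null_zero null_add null_uminus)

end

section \<open>Vertex cones and the proof of the theorem\<close>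

lemma hs_prod_eq_indicator:
  assumes "finite I"
  shows "(\<Prod>j\<in>I. hs j x) = (if \<forall>j\<in>I. 0 \<le> slack j x then 1 else 0)"
  using assms by (induction I rule: finite_induct) (auto simp: hs_def)

lemma germ_prod_eq_vertex_cone:
  assumes fin: "finite I" and P: "P = {x. \<forall>j\<in>I. 0 \<le> slack j x}" and v: "v \<in> P"
  shows "(\<Prod>j\<in>I. germ v j x) = (if x \<in> vertex_cone v P then 1 else 0)"
proof -
  obtain e where e: "e > 0" "\<And>j. j \<in> I \<Longrightarrow> germ v j x = hs j (v + e *\<^sub>R (x - v))"
    using germ_eq_hs_near[OF fin] by blast
  have "(\<Prod>j\<in>I. germ v j x) = (\<Prod>j\<in>I. hs j (v + e *\<^sub>R (x - v)))"
    by (rule prod.cong) (auto simp: e(2))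
  then have *: "(\<Prod>j\<in>I. germ v j x) = (if v + e *\<^sub>R (x - v) \<in> P then 1 else 0)"
    by (simp add: hs_prod_eq_indicator[OF fin] P)
  show ?thesis
  proof (cases "x \<in> vertex_cone v P")
    case True
    then obtain u k where uk: "x = v + k *\<^sub>R (u - v)" "u \<in> P" "0 \<le> k"
      by (auto simp: vertex_cone_def)
    have "germ v j x = 1" if j: "j \<in> I" for j
    proof -
      have "0 \<le> slack j v" "0 \<le> slack j u" using j v uk(2) P by auto
      moreover have "slack j u = slack j v + rat_vec (fst j) \<bullet> (u - v)"
        by (simp add: slack_def inner_diff_right)
      ultimately show ?thesis
        using uk(3) by (auto simp: germ_def uk(1))
    qed
    then show ?thesis using True by simp
  next
    case False
    \<comment> \<open>If the nearby point belonged to \<open>P\<close>, scaling by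
      \<open>1 / e\<close> from \<open>v\<close> would put \<open>x\<close> into the cone.\<close>
    have "x = v + (1 / e) *\<^sub>R ((v + e *\<^sub>R (x - v)) - v)" using e(1) by simp
    then have "v + e *\<^sub>R (x - v) \<notin> P"
      using False e(1) unfolding vertex_cone_def mem_Collect_eq
      by (metis less_imp_le zero_less_divide_1_iff)
    then show ?thesis using False * by simp
  qed
qed

text \<open>On a segment in \<open>P\<close> through \<open>v\<close>, a slack that vanishes at the
  interior point \<open>v\<close> is a positive combination of nonnegative end values, so it
  vanishes at both ends. Spanning normals then make the ends equal.\<close>

lemma extreme_point_of_spanning_tight:
  assumes P: "P = {x. \<forall>j\<in>I. 0 \<le> slack j x}" and v: "v \<in> P"
    and span: "vec.span (fst ` {j \<in> I. slack j v = 0}) = UNIV"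
  shows "v extreme_point_of P"
  unfolding extreme_point_of_def
proof (intro conjI v ballI notI)
  fix a b assume ab: "a \<in> P" "b \<in> P" "v \<in> open_segment a b"
  then obtain t where t: "a \<noteq> b" "0 < t" "t < 1" "v = (1 - t) *\<^sub>R a + t *\<^sub>R b"
    by (auto simp: in_segment)
  have "rat_vec n \<bullet> (a - b) = 0" if n: "n \<in> fst ` {j \<in> I. slack j v = 0}" for n
  proof -
    obtain j where j: "j \<in> I" "slack j v = 0" "n = fst j" using n by blast
    have "slack j v = (1 - t) * slack j a + t * slack j b"
      by (simp add: slack_def t(4) inner_add_right algebra_simps)
    moreover have "0 \<le> slack j a" "0 \<le> slack j b" using ab j(1) P by auto
    ultimately have "(1 - t) * slack j a = 0" "t * slack j b = 0"
      using j(2) t(2,3) by (smt (verit) mult_nonneg_nonneg)+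
    then have "slack j a = 0" "slack j b = 0" using t by auto
    then show ?thesis by (simp add: slack_def j(3) inner_diff_right)
  qed
  then have "a - b = 0" by (rule spanning_orthogonal_zero[OF span])
  then show False using t(1) by simp
qed

theorem mainTheorem7:
  fixes P :: "(real ^ 'd::finite) set"
    and \<phi> :: "int ^ 'd \<Rightarrow> 'g::ab_group_add"
    and w :: "('d \<Rightarrow>\<^sub>0 nat) \<Rightarrow>\<^sub>0 'r::comm_ring_1"
  assumes "\<And>\<alpha> \<beta>. \<phi> (\<alpha> + \<beta>) = \<phi> \<alpha> + \<phi> \<beta>"
    and "rational_polytope P"
  shows "point_transform P \<phi> w
    = (\<Sum>v | v extreme_point_of P. point_transform (vertex_cone v P) \<phi> w)"
proof -
  interpret polynomial_weight \<phi> "poly_eval w"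
    using assms(1) diff_nilpotent_poly_eval by unfold_locales
  obtain I where fin: "finite I" and P: "P = {x. \<forall>j\<in>I. 0 \<le> slack j x}"
    using rational_polytope_halfspaces[OF assms(2)] unfolding slack_def by blast
  let ?X = "{v. v extreme_point_of P}"
  have finX: "finite ?X"
    using assms(2) by (simp add: rational_polytope_def finite_polyhedron_extreme_points polytope_imp_polyhedron)
  \<comment> \<open>One candidate apex is chosen for each subset of \<open>I\<close>; for subsets
    without a common zero the choice is arbitrary and harmless.\<close>
  define V where "V = ?X \<union> (\<lambda>J. SOME v. \<forall>j\<in>J. slack j v = 0) ` Pow I"
  have finV: "finite V" using finX fin by (simp add: V_def)
  have apex: "\<exists>v\<in>V. \<forall>j\<in>J. slack j v = 0" if J: "J \<subseteq> I" "indep_normals J" for J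
  proof -
    have "\<forall>j\<in>J. slack j (SOME v. \<forall>j\<in>J. slack j v = 0) = 0"
      using exists_apex[OF finite_subset[OF J(1) fin] J(2)] by (rule someI_ex)
    then show ?thesis using J(1) by (auto simp: V_def)
  qed
  define T where "T v = (\<lambda>x. \<Prod>j\<in>I. germ v j x)" for v
  obtain F where F: "\<And>v. series_represents (weighted_series \<phi> (poly_eval w) (T v)) (F v)"
    using germ_prod_representable[OF fin] unfolding T_def representable_def by metis
  \<comment> \<open>At a point of \<open>P\<close> that is not a vertex the tight normals do not
    span; at a point outside \<open>P\<close> some germ is identically zero.\<close>
  have F_zero: "F v = 0" if v: "v \<notin> ?X" for v
  proof -
    have "null (T v)"
    proof (cases "v \<in> P")
      case True
      then show ?thesis
        using v extreme_point_of_spanning_tight[OF P] germ_prod_null unfolding T_def by blast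
    next
      case False
      then obtain j where "j \<in> I" "slack j v < 0" using P by force
      then have "T v = (\<lambda>_. 0)"
        unfolding T_def using fin by (intro ext prod_zero) (auto simp: germ_def intro!: bexI[of _ j])
      then show ?thesis by (simp add: null_zero)
    qed
    then show ?thesis using F[of v] series_represents_unique unfolding null_def by blast
  qed
  have cone: "point_transform (vertex_cone v P) \<phi> w = F v" if v: "v \<in> ?X" for v
  proof -
    have "v \<in> P" using v by (simp add: extreme_point_of_def)
    then have "point_series (vertex_cone v P) \<phi> w = weighted_series \<phi> (poly_eval w) (T v)"
      unfolding T_def by (intro point_series_eq_weighted_series germ_prod_eq_vertex_cone fin P)
    then show ?thesis
      unfolding point_transform_def using F[of v] by (simp add: series_to_rational_eqI)
  qed
  define D where "D = (\<lambda>x. (\<Prod>j\<in>I. hs j x) - (\<Sum>v\<in>V. T v x))"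
  have "null D" unfolding D_def T_def using Brion_null[OF fin finV apex] .
  \<comment> \<open>The series of \<open>P\<close> is the null error \<open>D\<close> plus the germ
    series over \<open>V\<close>, each of which has a rational function.\<close>
  then have "series_represents
      (\<lambda>\<alpha>. weighted_series \<phi> (poly_eval w) D \<alpha> + (\<Sum>v\<in>V. weighted_series \<phi> (poly_eval w) (T v) \<alpha>))
      (0 + (\<Sum>v\<in>V. F v))"
    unfolding null_def by (intro series_represents_add series_represents_sum F)
  moreover have "(\<lambda>\<alpha>. weighted_series \<phi> (poly_eval w) D \<alpha> + (\<Sum>v\<in>V. weighted_series \<phi> (poly_eval w) (T v) \<alpha>))
      = point_series P \<phi> w"
  proof -
    have "point_series P \<phi> w = weighted_series \<phi> (poly_eval w) (\<lambda>x. D x + (\<Sum>v\<in>V. T v x))"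
      by (rule point_series_eq_weighted_series) (simp add: D_def hs_prod_eq_indicator[OF fin] P)
    then show ?thesis by (simp add: weighted_series_add weighted_series_sum)
  qed
  ultimately have "point_transform P \<phi> w = (\<Sum>v\<in>V. F v)"
    unfolding point_transform_def by (simp add: series_to_rational_eqI)
  also have "\<dots> = (\<Sum>v\<in>?X. F v)"
    \<comment> \<open>The auxiliary points of \<open>V\<close> that are not vertices contribute
      zero.\<close>
    using finV F_zero by (intro sum.mono_neutral_right) (auto simp: V_def)
  also have "\<dots> = (\<Sum>v | v extreme_point_of P. point_transform (vertex_cone v P) \<phi> w)"
    by (rule sum.cong) (simp_all add: cone)
  finally show ?thesis .
qed

end
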